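(* Let $\lambda\in\mathbb{R}$ and $\omega>0$, and let $Q(u)=Q(u;\lambda,1,\omega)$ be the quantile function of the generalized inverse Gaussian distribution with parameters $(\lambda,\eta,\omega)$, $\eta=1$. Put $$v=2K_\lambda(\omega)(1-u),\qquad y=-\frac2\omega\ln v.$$ Then $$Q(u)\sim y+\sum_{n=0}^\infty\frac{P_n(\ln y)}{y^n}\quad\text{as }u\to1,$$ where $P_0(\xi)$ is a polynomial of degree $1$ and $P_n(\xi)$ are polynomials of degree $n$ for $n\ge1$, determined up to the constants $c_0,\dots,c_n$ by $$P_0(\xi)=\frac{2(\lambda-1)}\omega\xi+c_0,$$ $$P_n(\xi)=\frac{2(\lambda-1)}\omega\left(P_{n-1}(\xi)-P_{n-1}(0)\right)-\frac{2(\lambda-1)}\omega(n-1)\int_0^\xi P_{n-1}(t)\,dt+c_n,\quad n\ge1.$$ The constants $c_0,\dots,c_n$ are obtained as follows: starting with $u_0(t)=\log(b_0)$, compute $$u_k(t)=\frac{2(\lambda-1)}\omega\log\left(1+tu_{k-1}(t)\right)+\frac2\omega\log D\left(\frac t{1+tu_{k-1}(t)}\right),\quad k=1,\dots,n+1,$$ and set $c_k=[t^k]u_{n+1}(t)$ for $k=0,\dots,n$, where $D(z)=\sum_{k=0}^\infty b_kz^k$ is the formal power series with $$b_k=\sum_{j=0}^k\frac{(-1)^{k-j}}{(k-j)!}\left(\frac\omega2\right)^{k-2j-1}\prod_{i=0}^{j-1}(\lambda-k+i).$$ The first few terms are $$Q(u)\sim y+\frac{2\left((\lambda-1)\ln y+\ln\left(\frac2\omega\right)\right)}\omega+\frac{4\lambda-\omega^2-4+4(\lambda-1)^2\ln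 y+4(\lambda-1)\ln\left(\frac2\omega\right)}{\omega^2y}+\cdots\quad\text{as }u\to1.$$ Moreover, $$Q(u;\lambda,1,\omega)=\frac1{Q(1-u;-\lambda,1,\omega)},$$ which gives the asymptotic behaviour of $Q(u;\lambda,1,\omega)$ as $u\to0$.
   Context: $K_\nu$ denotes the modified Bessel function of the second kind (also called of the third kind). The generalized inverse Gaussian distribution with parameters $(\lambda,\eta,\omega)$, $\eta=1$, has density $$f(x;\lambda,1,\omega)=\frac{1}{2K_\lambda(\omega)}x^{\lambda-1}e^{-\frac\omega2\left(x^{-1}+x\right)},\quad x>0,$$ distribution function $F(x)=\int_0^xf(t)\,dt$ and quantile function $Q(\cdot;\lambda,1,\omega)=F^{-1}:(0,1)\to(0,\infty)$. The $u_k(t)$ are formal power series in $t$, the logarithms being of formal power series with positive constant term ($b_0=2/\omega>0$); $[t^k]$ denotes extraction of the coefficient of $t^k$. As $u\to1$, $y\to\infty$, and $\sim$ denotes an asymptotic expansion. Empty products equal $1$. The expansion is derived formally, by term-wise integration and rearrangement of series.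
   Formalization: The degrees of P_0 and P_n are claimed to be exactly 1 and n only for λ ≠ 1; for λ = 1 all P_n are the constants c_n, so only "degree at most 1" and "degree at most n" are asserted there. *)

theory Defs
  imports
    "HOL-Analysis.Analysis"
    "HOL-Computational_Algebra.Formal_Power_Series"
    "HOL-Library.Landau_Symbols"
begin

text \<open>
  Modified Bessel function of the second kind, for real order and positive argument, by its
  standard integral representation (Watson, 6.22(5); DLMF 10.32.9).
\<close>

definition bessel_K :: "real \<Rightarrow> real \<Rightarrow> real" where
  "bessel_K \<nu> x = (LBINT t=0..\<infinity>. exp (- x * cosh t) * cosh (\<nu> * t))"

definition gig_density :: "real \<Rightarrow> real \<Rightarrow> real \<Rightarrow> real" where
  "gig_density lam \<omega> x =
     1 / (2 * bessel_K lam \<omega>) * x powr (lam - 1) * exp (- (\<omega> / 2) * (1 / x + x))"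

definition gig_cdf :: "real \<Rightarrow> real \<Rightarrow> real \<Rightarrow> real" where
  "gig_cdf lam \<omega> x = (LBINT t=0..ereal x. gig_density lam \<omega> t)"

definition gig_quantile :: "real \<Rightarrow> real \<Rightarrow> real \<Rightarrow> real" where
  "gig_quantile lam \<omega> = inv_into {0<..} (gig_cdf lam \<omega>)"

definition gig_v :: "real \<Rightarrow> real \<Rightarrow> real \<Rightarrow> real" where
  "gig_v lam \<omega> u = 2 * bessel_K lam \<omega> * (1 - u)"

definition gig_y :: "real \<Rightarrow> real \<Rightarrow> real \<Rightarrow> real" where
  "gig_y lam \<omega> u = - (2 / \<omega>) * ln (gig_v lam \<omega> u)"

text \<open>
  Logarithm of a formal power series with positive constant term \<open>a\<close>:
  \<open>log f = ln a + log (1 + (f / a - 1))\<close>, where \<open>fps_ln 1\<close> is the series of \<open>log (1 + X)\<close>.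
\<close>

definition fps_log :: "real fps \<Rightarrow> real fps" where
  "fps_log f = fps_const (ln (fps_nth f 0)) +
     fps_compose (fps_ln 1) (fps_const (1 / fps_nth f 0) * f - 1)"

text \<open>The exponent \<open>k - 2j - 1\<close> may be negative, hence the integer power.\<close>

definition gig_b :: "real \<Rightarrow> real \<Rightarrow> nat \<Rightarrow> real" where
  "gig_b lam \<omega> k =
     (\<Sum>j\<le>k. (-1) ^ (k - j) / fact (k - j) * (\<omega> / 2) powi (int k - 2 * int j - 1)
               * (\<Prod>i<j. lam - real k + real i))"

definition gig_D :: "real \<Rightarrow> real \<Rightarrow> real fps" where
  "gig_D lam \<omega> = Abs_fps (gig_b lam \<omega>)"

primrec gig_u :: "real \<Rightarrow> real \<Rightarrow> nat \<Rightarrow> real fps" where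
  "gig_u lam \<omega> 0 = fps_const (ln (gig_b lam \<omega> 0))"
| "gig_u lam \<omega> (Suc k) =
     fps_const (2 * (lam - 1) / \<omega>) * fps_log (1 + fps_X * gig_u lam \<omega> k) +
     fps_const (2 / \<omega>) *
       fps_log (fps_compose (gig_D lam \<omega>) (fps_X / (1 + fps_X * gig_u lam \<omega> k)))"

text \<open>
  The coefficient of \<open>t\<^sup>k\<close> is already final in the iterate \<open>k + 1\<close>; that all later iterates
  yield the same value is part of the theorem.
\<close>

definition gig_c :: "real \<Rightarrow> real \<Rightarrow> nat \<Rightarrow> real" where
  "gig_c lam \<omega> k = fps_nth (gig_u lam \<omega> (Suc k)) k"

text \<open>
  The recursion for a given sequence of constants \<open>c\<close>. The interval integral is oriented,
  so it has the intended meaning for negative \<open>\<xi>\<close> too.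
\<close>

primrec gig_P :: "real \<Rightarrow> real \<Rightarrow> (nat \<Rightarrow> real) \<Rightarrow> nat \<Rightarrow> real \<Rightarrow> real" where
  "gig_P lam \<omega> c 0 = (\<lambda>\<xi>. 2 * (lam - 1) / \<omega> * \<xi> + c 0)"
| "gig_P lam \<omega> c (Suc m) =
     (\<lambda>\<xi>. 2 * (lam - 1) / \<omega> * (gig_P lam \<omega> c m \<xi> - gig_P lam \<omega> c m 0)
         - 2 * (lam - 1) / \<omega> * real m * (LBINT t=0..ereal \<xi>. gig_P lam \<omega> c m t)
         + c (Suc m))"

text \<open>
  Generalized asymptotic expansion (Erdelyi) of \<open>f\<close> along the filter \<open>F\<close>, with terms \<open>g n\<close>,
  with respect to the asymptotic scale \<open>\<phi> n\<close>.
\<close>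

definition asymp_expansion ::
  "(real \<Rightarrow> real) \<Rightarrow> (nat \<Rightarrow> real \<Rightarrow> real) \<Rightarrow> (nat \<Rightarrow> real \<Rightarrow> real) \<Rightarrow> real filter \<Rightarrow> bool" where
  "asymp_expansion f g \<phi> F \<longleftrightarrow>
     (\<forall>n. \<phi> (Suc n) \<in> o[F](\<phi> n)) \<and>
     (\<forall>N. (\<lambda>x. f x - (\<Sum>n\<le>N. g n x)) \<in> o[F](\<phi> N))"

end

theory Submission
  imports Defs "HOL-Real_Asymp.Real_Asymp"
begin

text \<open>
  Write \<open>x = Q(u)\<close> and \<open>f = x - y\<close>. Since \<open>v\<close> is the tail integral, it equals
  \<open>x powr (lam - 1) * exp (- \<omega> * x / 2) * D\<close>, where \<open>D\<close> has an expansion in powers of \<open>1 / x\<close>. Taking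
  logarithms gives the fixpoint equation
  \<open>f = a * ln y + a * ln (1 + f / y) + (2 / \<omega>) * ln D\<close> with \<open>a = 2 * (lam - 1) / \<omega>\<close>,
  whose right-hand side depends on \<open>f\<close> only through \<open>f / y\<close>. Hence an expansion of \<open>f\<close> to some
  order yields one to the next order, and the coefficients are those of the formal fixpoint in
  which \<open>\<xi> = ln y\<close> is an independent parameter. For \<open>\<xi> = 0\<close> that fixpoint is the series of
  the constants \<open>c k\<close>. For general \<open>\<xi>\<close> it is the series of the \<open>P n \<xi>\<close>: their recursion is a
  transport equation in \<open>\<xi>\<close> and \<open>t\<close>, so the defect in the fixpoint equation solves a
  homogeneous transport equation, and it vanishes at \<open>\<xi> = 0\<close>.
\<close>

unbundle no vec_syntax
unbundle fps_syntax

section \<open>Formal power series and the polynomials \<open>P n\<close>\<close>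

text \<open>A change of variables lies behind the transport equation. With \<open>y = 1 / t\<close>
  and \<open>x = y + W\<close>, the fixpoint equation reads \<open>x = y + a * (\<xi> - ln y) + a *
  ln x + (2 / \<omega>) * ln D(1 / x)\<close>. So \<open>x\<close> depends on \<open>\<xi>\<close>
  and \<open>y\<close> only through \<open>y + a * (\<xi> - ln y)\<close>, which gives
  \<open>(1 - a / y) * dx/d\<xi> = a * dx/dy\<close>; in terms of \<open>t\<close> this is the
  differentiated recursion of the \<open>P n\<close>.

  Two obstacles shape the analysis. The coefficients contain powers of \<open>ln y\<close>, so the
  remainder after \<open>N\<close> terms need not be O(\<open>1 / y ^ N\<close>). Errors are
  measured as O(\<open>y powr (\<epsilon> - N)\<close>) for all \<open>\<epsilon> > 0\<close>, and
  the little-o statement is drawn from the approximation one order further. Moreover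
  \<open>Q\<close> is not explicit, whereas \<open>y\<close> is an explicit function of
  \<open>x = Q(u)\<close>: the expansion is proved for \<open>x\<close> tending to infinity and
  pulled back along \<open>Q\<close> at the end.

  The series \<open>D\<close> is treated purely as an asymptotic series. Its remainders are bounded
  by comparing derivatives of functions that vanish at infinity, which replaces the formal term-wise
  integration.\<close>

definition fps_eq_upto :: "nat \<Rightarrow> 'a::zero fps \<Rightarrow> 'a fps \<Rightarrow> bool" where
  "fps_eq_upto n A B \<longleftrightarrow> (\<forall>k<n. A $ k = B $ k)"

lemma fps_eq_upto_refl [simp]: "fps_eq_upto n A A"
  by (simp add: fps_eq_upto_def)

lemma fps_eq_upto_add:
  "fps_eq_upto n A B \<Longrightarrow> fps_eq_upto n C D \<Longrightarrow> fps_eq_upto n (A + C) (B + D :: 'a::monoid_add fps)"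
  by (simp add: fps_eq_upto_def)

lemma fps_eq_upto_mult:
  "fps_eq_upto n A B \<Longrightarrow> fps_eq_upto n C D \<Longrightarrow> fps_eq_upto n (A * C) (B * D :: 'a::semiring_0 fps)"
  by (simp add: fps_eq_upto_def fps_mult_nth)

lemma fps_eq_upto_power:
  "fps_eq_upto n A B \<Longrightarrow> fps_eq_upto n (A ^ k) (B ^ k :: 'a::semiring_1 fps)"
  by (induction k) (auto intro: fps_eq_upto_mult)

lemma fps_eq_upto_compose:
  "fps_eq_upto n A B \<Longrightarrow> fps_eq_upto n (F oo A) (F oo B :: 'a::semiring_1 fps)"
  using fps_eq_upto_power[of n A B] by (simp add: fps_eq_upto_def fps_compose_nth)

lemma fps_eq_upto_X_mult:
  "fps_eq_upto n A B \<Longrightarrow> fps_eq_upto (Suc n) (fps_X * A) (fps_X * B :: 'a::semiring_1 fps)"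
  by (auto simp: fps_eq_upto_def less_Suc_eq_0_disj)

lemma fps_log_one_plus_X_mult: "fps_log (1 + fps_X * U) = fps_ln 1 oo (fps_X * U)"
  by (simp add: fps_log_def)

lemma fps_log_compose:
  assumes "Z $ 0 = 0"
  shows "fps_log (F oo Z) = fps_log F oo Z"
proof -
  have "fps_log F oo Z = fps_const (ln (F $ 0)) +
      ((fps_ln 1 oo (fps_const (1 / F $ 0) * F - 1)) oo Z)"
    by (simp add: fps_log_def fps_compose_add_distrib)
  also have "(fps_ln 1 oo (fps_const (1 / F $ 0) * F - 1)) oo Z =
      fps_ln 1 oo ((fps_const (1 / F $ 0) * F - 1) oo Z)" if "F $ 0 \<noteq> 0"
    using that assms by (intro fps_compose_assoc [symmetric]) auto
  also have "(fps_const (1 / F $ 0) * F - 1) oo Z = fps_const (1 / F $ 0) * (F oo Z) - 1"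
    using assms by (simp add: fps_compose_sub_distrib fps_compose_mult_distrib)
  finally have nonzero: ?thesis if "F $ 0 \<noteq> 0"
    using that by (simp add: fps_log_def)
  \<comment> \<open>If the constant term vanishes, \<open>1 / 0 = 0\<close> leaves
    \<open>- 1\<close> as the inner series. Composition sums only up to the coefficient index, and
    \<open>fps_ln 1\<close> has no constant term, so the composition is 0 and
    \<open>fps_log F\<close> is a constant.\<close>
  have "fps_ln (1::real) oo - 1 = 0"
  proof (rule fps_ext)
    fix n
    have "((- 1 :: real fps) ^ i) $ n = (if n = 0 then (- 1) ^ i else 0)" for i
      by (cases "even i") auto
    thus "(fps_ln (1::real) oo - 1) $ n = 0 $ n"
      by (cases "n = 0") (simp_all add: fps_compose_nth)
  qed
  hence ?thesis if "F $ 0 = 0"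
    using that by (simp add: fps_log_def)
  with nonzero show ?thesis by blast
qed

text \<open>In this form \<open>U\<close> enters through a composition with
  \<open>fps_X * U\<close>, for which congruence and derivative rules are available.\<close>

lemma fps_X_div_one_plus_X_mult:
  "fps_X / (1 + fps_X * U :: real fps) = fps_X * (inverse (1 + fps_X) oo (fps_X * U))"
proof -
  have "inverse (1 + fps_X :: real fps) oo (fps_X * U) = inverse (1 + fps_X * U)"
    by (subst fps_inverse_compose) (auto simp: fps_compose_add_distrib)
  thus ?thesis by (simp add: fps_divide_unit)
qed

text \<open>The shift \<open>s\<close> will be \<open>a * \<xi>\<close>; with \<open>s = 0\<close>
  this is the recursion of \<open>gig_u\<close>. The logarithms are compositions with fixed outer
  series, so that \<open>U\<close> occurs only inside \<open>fps_X * U\<close>.\<close>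

definition gig_step :: "real \<Rightarrow> real \<Rightarrow> real \<Rightarrow> real fps \<Rightarrow> real fps" where
  "gig_step lam \<omega> s U = fps_const s
     + fps_const (2 * (lam - 1) / \<omega>) * (fps_ln 1 oo (fps_X * U))
     + fps_const (2 / \<omega>) * (fps_log (gig_D lam \<omega>) oo (fps_X / (1 + fps_X * U)))"

lemma gig_u_Suc: "gig_u lam \<omega> (Suc k) = gig_step lam \<omega> 0 (gig_u lam \<omega> k)"
  by (simp add: gig_step_def fps_log_one_plus_X_mult fps_log_compose)

text \<open>The step is a contraction in the t-adic sense: \<open>U\<close> occurs only multiplied
  by \<open>fps_X\<close>, and that factor gains one coefficient of agreement.\<close>

lemma fps_eq_upto_gig_step:
  assumes "fps_eq_upto n U V"
  shows "fps_eq_upto (Suc n) (gig_step lam \<omega> s U) (gig_step lam \<omega> s V)"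
proof -
  have XU: "fps_eq_upto (Suc n) (fps_X * U) (fps_X * V)"
    by (rule fps_eq_upto_X_mult[OF assms])
  note ln = fps_eq_upto_compose[OF XU]
  note log = fps_eq_upto_compose[OF fps_eq_upto_mult[OF fps_eq_upto_refl fps_eq_upto_compose[OF XU]]]
  show ?thesis
    unfolding gig_step_def fps_X_div_one_plus_X_mult
    by (intro fps_eq_upto_add fps_eq_upto_mult[OF fps_eq_upto_refl] fps_eq_upto_refl ln log)
qed

lemma fps_eq_upto_gig_u_Suc: "fps_eq_upto k (gig_u lam \<omega> k) (gig_u lam \<omega> (Suc k))"
proof (induction k)
  case (Suc k)
  thus ?case unfolding gig_u_Suc by (rule fps_eq_upto_gig_step)
qed (simp add: fps_eq_upto_def)

lemma gig_u_nth_stable: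
  assumes "k < m"
  shows "gig_u lam \<omega> m $ k = gig_c lam \<omega> k"
  using assms
proof (induction m)
  case (Suc m)
  show ?case
  proof (cases "k = m")
    case False
    hence "gig_u lam \<omega> (Suc m) $ k = gig_u lam \<omega> m $ k"
      using fps_eq_upto_gig_u_Suc[of m lam \<omega>] Suc.prems unfolding fps_eq_upto_def by auto
    thus ?thesis using Suc False by simp
  qed (simp only: gig_c_def)
qed simp

text \<open>The series of constants agrees with the iterate \<open>n\<close> below index
  \<open>n\<close>; after one step it agrees with the iterate \<open>n + 1\<close> up to index
  \<open>n\<close>, where that iterate has the coefficient \<open>c n\<close>.\<close>

lemma gig_step_Abs_fps_gig_c: "gig_step lam \<omega> 0 (Abs_fps (gig_c lam \<omega>)) = Abs_fps (gig_c lam \<omega>)"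
proof (rule fps_ext)
  fix n
  have "fps_eq_upto n (gig_u lam \<omega> n) (Abs_fps (gig_c lam \<omega>))"
    by (simp add: fps_eq_upto_def gig_u_nth_stable)
  from fps_eq_upto_gig_step[OF this, of lam \<omega> 0]
  show "gig_step lam \<omega> 0 (Abs_fps (gig_c lam \<omega>)) $ n = Abs_fps (gig_c lam \<omega>) $ n"
    unfolding gig_u_Suc [symmetric] by (simp add: fps_eq_upto_def gig_u_nth_stable del: gig_u.simps)
qed

section \<open>Derivatives of formal power series with respect to a real parameter\<close>

definition fps_has_deriv :: "(real \<Rightarrow> real fps) \<Rightarrow> (real \<Rightarrow> real fps) \<Rightarrow> bool" where
  "fps_has_deriv A A' \<longleftrightarrow> (\<forall>n x. ((\<lambda>x. A x $ n) has_real_derivative A' x $ n) (at x))"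

lemma fps_has_deriv_const: "fps_has_deriv (\<lambda>_. A) (\<lambda>_. 0)"
  by (simp add: fps_has_deriv_def)

lemma fps_has_deriv_diff:
  "fps_has_deriv A A' \<Longrightarrow> fps_has_deriv B B' \<Longrightarrow> fps_has_deriv (\<lambda>x. A x - B x) (\<lambda>x. A' x - B' x)"
  by (auto simp: fps_has_deriv_def intro!: derivative_eq_intros)

lemma fps_has_deriv_mult:
  assumes "fps_has_deriv A A'" "fps_has_deriv B B'"
  shows "fps_has_deriv (\<lambda>x. A x * B x) (\<lambda>x. A' x * B x + A x * B' x)"
  unfolding fps_has_deriv_def
proof (intro allI)
  fix n x
  have "((\<lambda>x. \<Sum>i=0..n. A x $ i * B x $ (n - i)) has_real_derivative
      (\<Sum>i=0..n. A x $ i * B' x $ (n - i) + A' x $ i * B x $ (n - i))) (at x)"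
    using assms by (intro DERIV_sum DERIV_mult') (auto simp: fps_has_deriv_def)
  thus "((\<lambda>x. (A x * B x) $ n) has_real_derivative (A' x * B x + A x * B' x) $ n) (at x)"
    by (simp add: fps_mult_nth sum.distrib add.commute)
qed

lemma fps_has_deriv_cmult:
  "fps_has_deriv A A' \<Longrightarrow> fps_has_deriv (\<lambda>x. C * A x) (\<lambda>x. C * A' x)"
  using fps_has_deriv_mult[OF fps_has_deriv_const, of A A' C] by simp

lemma fps_has_deriv_power:
  assumes "fps_has_deriv A A'"
  shows "fps_has_deriv (\<lambda>x. A x ^ k) (\<lambda>x. of_nat k * A x ^ (k - 1) * A' x)"
proof (induction k)
  case 0
  show ?case using fps_has_deriv_const[of 1] by simp
next
  case (Suc k)
  have "A' x * A x ^ k + A x * (of_nat k * A x ^ (k - 1) * A' x) =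
          of_nat (Suc k) * A x ^ k * A' x" for x
    by (cases k) (auto simp: algebra_simps)
  with fps_has_deriv_mult[OF assms Suc.IH] show ?case by simp
qed

lemma fps_has_deriv_compose:
  assumes B: "fps_has_deriv B B'" and B0: "\<And>x. B x $ 0 = 0"
  shows "fps_has_deriv (\<lambda>x. F oo B x) (\<lambda>x. (fps_deriv F oo B x) * B' x)"
  unfolding fps_has_deriv_def
proof (intro allI)
  fix n x
  have "((\<lambda>x. B x $ 0) has_real_derivative B' x $ 0) (at x)"
    using B by (simp add: fps_has_deriv_def)
  hence B'0: "B' x $ 0 = 0"
    unfolding B0 by (intro DERIV_unique[of "\<lambda>_. 0"]) auto
  have "((\<lambda>x. \<Sum>i=0..n. F $ i * (B x ^ i) $ n) has_real_derivative
      (\<Sum>i=0..n. F $ i * (of_nat i * B x ^ (i - 1) * B' x) $ n)) (at x)"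
    using fps_has_deriv_power[OF B]
    by (intro DERIV_sum DERIV_cmult) (auto simp: fps_has_deriv_def)
  also have "(\<Sum>i=0..n. F $ i * (of_nat i * B x ^ (i - 1) * B' x) $ n) =
      (\<Sum>i<n. F $ Suc i * (of_nat (Suc i) * B x ^ i * B' x) $ n)"
    unfolding atLeast0AtMost lessThan_Suc_atMost [symmetric]
    by (subst sum.lessThan_Suc_shift) simp
  also have "\<dots> = (\<Sum>i<n. fps_deriv F $ i * (B x ^ i * B' x) $ n)"
  proof (intro sum.cong refl)
    fix i
    have "(of_nat (Suc i) * B x ^ i * B' x) $ n = of_nat (Suc i) * (B x ^ i * B' x) $ n"
      by (simp only: fps_of_nat [symmetric] mult.assoc fps_mult_left_const_nth)
    thus "F $ Suc i * (of_nat (Suc i) * B x ^ i * B' x) $ n = fps_deriv F $ i * (B x ^ i * B' x) $ n"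
      by simp
  qed
  \<comment> \<open>The index shift has lost the summand \<open>i = n\<close>. It is zero anyway:
    \<open>B x ^ n\<close> starts at degree \<open>n\<close>, and \<open>B' x\<close> has no
    constant term because that of \<open>B x\<close> is constantly 0.\<close>
  also have "\<dots> = (\<Sum>i\<le>n. fps_deriv F $ i * (B x ^ i * B' x) $ n)"
  proof -
    have "(B x ^ n) $ j * B' x $ (n - j) = 0" if "j \<le> n" for j
      using that B'0 startsby_zero_power_prefix[OF B0[of x], of n] by (cases "j = n") auto
    hence "(B x ^ n * B' x) $ n = 0"
      unfolding fps_mult_nth by (intro sum.neutral) simp
    thus ?thesis by (simp flip: lessThan_Suc_atMost)
  qed
  also have "\<dots> = (\<Sum>j=0..n. (\<Sum>i\<le>n. fps_deriv F $ i * (B x ^ i) $ j) * B' x $ (n - j))"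
    unfolding fps_mult_nth sum_distrib_left sum_distrib_right
    by (subst sum.swap) (simp add: mult_ac)
  also have "\<dots> = (\<Sum>j=0..n. (fps_deriv F oo B x) $ j * B' x $ (n - j))"
  proof (intro sum.cong refl arg_cong2[of _ _ _ _ "(*)"])
    fix j assume "j \<in> {0..n}"
    thus "(\<Sum>i\<le>n. fps_deriv F $ i * (B x ^ i) $ j) = (fps_deriv F oo B x) $ j"
      unfolding fps_compose_nth using startsby_zero_power_prefix[OF B0[of x]]
      by (intro sum.mono_neutral_right) auto
  qed
  finally show "((\<lambda>x. (F oo B x) $ n) has_real_derivative ((fps_deriv F oo B x) * B' x) $ n) (at x)"
    by (simp add: fps_compose_nth fps_mult_nth)
qed

section \<open>The polynomials \<open>P n\<close> and their degrees\<close>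

definition fps_P :: "real \<Rightarrow> real \<Rightarrow> real \<Rightarrow> real fps" where
  "fps_P lam \<omega> x = Abs_fps (\<lambda>n. gig_P lam \<omega> (gig_c lam \<omega>) n x)"

definition poly_integral0 :: "real poly \<Rightarrow> real poly" where
  "poly_integral0 p = (\<Sum>i\<le>degree p. monom (coeff p i / real (Suc i)) (Suc i))"

lemma pderiv_poly_integral0: "pderiv (poly_integral0 p) = p"
proof -
  have "pderiv (poly_integral0 p) = (\<Sum>i\<le>degree p. pderiv (monom (coeff p i / real (Suc i)) (Suc i)))"
    by (simp add: poly_integral0_def higher_pderiv_sum[of 1, simplified])
  also have "\<dots> = (\<Sum>i\<le>degree p. monom (coeff p i) i)"
    by (intro sum.cong refl) (simp add: pderiv_monom del: of_nat_Suc)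
  finally show ?thesis by (simp add: poly_as_sum_of_monoms)
qed

lemma coeff_poly_integral0:
  "coeff (poly_integral0 p) n = (if n = 0 then 0 else coeff p (n - 1) / real n)"
proof (cases n)
  case 0
  thus ?thesis by (simp add: poly_integral0_def coeff_sum)
next
  case (Suc m)
  have "coeff (pderiv (poly_integral0 p)) m = coeff p m" by (simp add: pderiv_poly_integral0)
  thus ?thesis using Suc by (simp add: coeff_pderiv field_simps)
qed

lemma poly_LBINT:
  "(LBINT t=0..ereal x. poly p t) = poly (poly_integral0 p) x"
proof -
  have "(LBINT t=ereal 0..ereal x. poly p t) = poly (poly_integral0 p) x - poly (poly_integral0 p) 0"
  proof (rule interval_integral_FTC_finite)
    show "continuous_on {min 0 x..max 0 x} (poly p)" by (intro continuous_intros)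
    fix t assume "min 0 x \<le> t" "t \<le> max 0 x"
    have "(poly (poly_integral0 p) has_real_derivative poly p t) (at t)"
      using poly_DERIV[of "poly_integral0 p" t] by (simp only: pderiv_poly_integral0)
    thus "(poly (poly_integral0 p) has_vector_derivative poly p t) (at t within {min 0 x..max 0 x})"
      by (metis has_field_derivative_at_within has_real_derivative_iff_has_vector_derivative)
  qed
  thus ?thesis by (simp add: poly_0_coeff_0 coeff_poly_integral0 zero_ereal_def)
qed

text \<open>The recursion of \<open>gig_P\<close> with the integral replaced by the algebraic
  antiderivative, so that coefficients and degrees become computable.\<close>

primrec gig_poly :: "real \<Rightarrow> real \<Rightarrow> (nat \<Rightarrow> real) \<Rightarrow> nat \<Rightarrow> real poly" where
  "gig_poly lam \<omega> c 0 = [:c 0, 2 * (lam - 1) / \<omega>:]"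
| "gig_poly lam \<omega> c (Suc m) =
     smult (2 * (lam - 1) / \<omega>) (gig_poly lam \<omega> c m - [:coeff (gig_poly lam \<omega> c m) 0:])
     - smult (2 * (lam - 1) / \<omega> * real m) (poly_integral0 (gig_poly lam \<omega> c m)) + [:c (Suc m):]"

lemma gig_P_eq_poly: "gig_P lam \<omega> c n = poly (gig_poly lam \<omega> c n)"
proof (induction n)
  case (Suc n)
  show ?case by (rule ext) (simp add: Suc poly_LBINT poly_0_coeff_0 algebra_simps)
qed (auto simp: algebra_simps)

lemma coeff_gig_poly_Suc:
  "coeff (gig_poly lam \<omega> c (Suc m)) (Suc k) = 2 * (lam - 1) / \<omega> *
     (coeff (gig_poly lam \<omega> c m) (Suc k) - real m / real (Suc k) * coeff (gig_poly lam \<omega> c m) k)"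
  by (simp add: coeff_poly_integral0 coeff_pCons diff_divide_distrib right_diff_distrib del: of_nat_Suc)

text \<open>Integration raises the degree by one in each step except from \<open>P 0\<close> to
  \<open>P 1\<close>, where it carries the factor 0. Hence the degrees run 1, 1, 2, 3, and so
  on.\<close>

lemma degree_gig_poly_le: "degree (gig_poly lam \<omega> c n) \<le> max 1 n"
proof (induction n)
  case (Suc n)
  have "coeff (gig_poly lam \<omega> c (Suc n)) k = 0" if "k > Suc n" for k
  proof -
    define j where "j = k - 1"
    have "k = Suc j" using that by (simp add: j_def)
    moreover from this have "coeff (gig_poly lam \<omega> c n) (Suc j) = 0" "n = 0 \<or> coeff (gig_poly lam \<omega> c n) j = 0"
      using Suc that by (auto intro!: coeff_eq_0)
    ultimately show ?thesis by (auto simp: coeff_gig_poly_Suc simp del: gig_poly.simps)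
  qed
  thus ?case by (intro degree_le) auto
qed simp

text \<open>With \<open>a = 2 * (lam - 1) / \<omega>\<close>, the leading coefficient is
  \<open>a\<close> for \<open>P 0\<close> and \<open>a^2\<close> for \<open>P 1\<close>; from
  \<open>P n\<close> to \<open>P (n + 1)\<close> with \<open>n \<ge> 1\<close> it is multiplied by
  \<open>- a * n / (n + 1)\<close>.\<close>

lemma coeff_gig_poly_nonzero:
  assumes "lam \<noteq> 1" "\<omega> \<noteq> 0"
  shows "coeff (gig_poly lam \<omega> c n) (max 1 n) \<noteq> 0"
proof (induction n)
  case (Suc n)
  show ?case
  proof (cases n)
    case 0
    thus ?thesis using assms coeff_gig_poly_Suc[of lam \<omega> c 0 0] by simp
  next
    case (Suc m)
    have "coeff (gig_poly lam \<omega> c n) (Suc n) = 0"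
      using degree_gig_poly_le[of lam \<omega> c n] Suc by (intro coeff_eq_0) auto
    moreover have "max 1 n = n" using Suc by simp
    ultimately show ?thesis using Suc.IH assms Suc
      by (auto simp: coeff_gig_poly_Suc simp del: gig_poly.simps)
  qed
qed (use assms in simp)

lemma degree_gig_poly:
  assumes "lam \<noteq> 1" "\<omega> \<noteq> 0"
  shows "degree (gig_poly lam \<omega> c n) = max 1 n"
  using degree_gig_poly_le coeff_gig_poly_nonzero[OF assms] le_degree by (metis order_antisym)

lemma poly_gig_poly_at_0: "poly (gig_poly lam \<omega> c n) 0 = c n"
  by (cases n) (simp_all add: poly_0_coeff_0 coeff_poly_integral0)

section \<open>The transport equation and the fixpoint property for all \<open>\<xi>\<close>\<close>

definition fps_P_deriv :: "real \<Rightarrow> real \<Rightarrow> real \<Rightarrow> real fps" where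
  "fps_P_deriv lam \<omega> x = Abs_fps (\<lambda>n. poly (pderiv (gig_poly lam \<omega> (gig_c lam \<omega>) n)) x)"

lemma fps_has_deriv_fps_P: "fps_has_deriv (fps_P lam \<omega>) (fps_P_deriv lam \<omega>)"
  by (simp add: fps_has_deriv_def fps_P_def fps_P_deriv_def gig_P_eq_poly poly_DERIV)

text \<open>Coefficient \<open>m + 1\<close> is the differentiated recursion: the derivative of
  \<open>P (m + 1)\<close> is \<open>a\<close> times that of \<open>P m\<close> minus
  \<open>a * m * P m\<close>. The inhomogeneous term \<open>a\<close> is the derivative of
  \<open>P 0\<close>.\<close>

lemma fps_P_transport:
  fixes lam \<omega> defines "a \<equiv> fps_const (2 * (lam - 1) / \<omega>)"
  shows "(1 - a * fps_X) * fps_P_deriv lam \<omega> x = a - a * fps_X\<^sup>2 * fps_deriv (fps_P lam \<omega> x)"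
proof (rule fps_ext)
  fix n
  show "((1 - a * fps_X) * fps_P_deriv lam \<omega> x) $ n =
          (a - a * fps_X\<^sup>2 * fps_deriv (fps_P lam \<omega> x)) $ n"
  proof (cases n)
    case 0
    thus ?thesis by (simp add: a_def fps_P_deriv_def pderiv_pCons)
  next
    case (Suc m)
    show ?thesis
      using Suc
      by (cases m)
         (simp_all add: a_def left_diff_distrib mult.assoc power2_eq_square fps_P_deriv_def fps_P_def gig_P_eq_poly
            pderiv_add pderiv_diff pderiv_smult pderiv_pCons pderiv_poly_integral0 algebra_simps del: of_nat_Suc)
  qed
qed

text \<open>The equation expresses coefficient \<open>n + 1\<close> of \<open>F'\<close> by
  coefficient \<open>n\<close> of \<open>F'\<close> and \<open>F\<close>. Once the latter vanish,
  the next coefficient of \<open>F\<close> is constant in the parameter and equals its initial value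
  0.\<close>

lemma transport_unique:
  fixes F F' :: "real \<Rightarrow> real fps" and a :: real
  assumes F: "fps_has_deriv F F'" and F0: "F 0 = 0"
    and eq: "\<And>x. (1 - fps_const a * fps_X) * F' x = - (fps_const a * fps_X\<^sup>2 * fps_deriv (F x))"
  shows "F x = 0"
proof -
  have "\<forall>x. F x $ n = 0" for n
  proof (induction n)
    case 0
    have "F' x $ 0 = 0" for x
      using arg_cong[OF eq[of x], of "\<lambda>f. f $ 0"] by simp
    hence "\<forall>x. ((\<lambda>x. F x $ 0) has_real_derivative 0) (at x)"
      using F unfolding fps_has_deriv_def by metis
    hence "F x $ 0 = F 0 $ 0" for x by (rule DERIV_isconst_all)
    thus ?case by (simp add: F0)
  next
    case (Suc n)
    have "F' x $ n = 0" for x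
    proof -
      have "((\<lambda>x. F x $ n) has_real_derivative F' x $ n) (at x)"
        using F by (simp add: fps_has_deriv_def)
      thus ?thesis using Suc by (intro DERIV_unique[of "\<lambda>_. 0"]) auto
    qed
    moreover have "F' x $ Suc n = a * F' x $ n - a * real n * F x $ n" for x
      using arg_cong[OF eq[of x], of "\<lambda>f. f $ Suc n"]
      by (cases n) (simp_all add: left_diff_distrib mult.assoc power2_eq_square)
    ultimately have "F' x $ Suc n = 0" for x using Suc by simp
    hence "\<forall>x. ((\<lambda>x. F x $ Suc n) has_real_derivative 0) (at x)"
      using F unfolding fps_has_deriv_def by metis
    hence "F x $ Suc n = F 0 $ Suc n" for x by (rule DERIV_isconst_all)
    thus ?case by (simp add: F0)
  qed
  thus ?thesis by (simp add: fps_eq_iff)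
qed


lemma fps_P_fixpoint:
  assumes "\<omega> \<noteq> 0"
  shows "gig_step lam \<omega> (2 * (lam - 1) / \<omega> * x) (fps_P lam \<omega> x) = fps_P lam \<omega> x"
proof -
  define a where "a = 2 * (lam - 1) / \<omega>"
  define H where "H = fps_log (gig_D lam \<omega>)"
  define W where "W = fps_P lam \<omega>"
  define W' where "W' = fps_P_deriv lam \<omega>"
  define G where "G = (\<lambda>x. 1 + fps_X * W x)"
  define Z where "Z = (\<lambda>x. fps_X * (inverse (1 + fps_X) oo (fps_X * W x)))"
  have G0: "G x $ 0 = 1" for x by (simp add: G_def)
  hence Gnz: "G x \<noteq> 0" for x by (metis fps_nonzero_nth zero_neq_one)
  have invG: "inverse (1 + fps_X) oo (fps_X * W x) = inverse (G x)" for x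
    by (subst fps_inverse_compose) (auto simp: fps_compose_add_distrib G_def)
  have Z: "Z x = fps_X * inverse (G x)" for x
    by (simp add: Z_def invG)
  have GI: "G x * inverse (G x) = 1" for x
    using inverse_mult_eq_1'[of "G x"] G0[of x] by simp
  have Z_alt: "fps_X / (1 + fps_X * W x) = Z x" for x
    by (simp add: Z_def fps_X_div_one_plus_X_mult)
  have dln: "fps_deriv (fps_ln (1::real)) = inverse (1 + fps_X)"
    by (simp add: fps_ln_deriv)
  have dinv: "fps_deriv (inverse (1 + fps_X)) = - (inverse (1 + fps_X :: real fps))\<^sup>2"
    by (subst fps_inverse_deriv) auto
  define \<Lambda> where "\<Lambda> = (\<lambda>x. fps_ln 1 oo (fps_X * W x))"
  define F where "F = (\<lambda>x. W x - fps_const (a * x) - fps_const a * \<Lambda> x - fps_const (2 / \<omega>) * (H oo Z x))"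
  \<comment> \<open>Read \<open>Z x\<close> as \<open>1 / X\<close> with
    \<open>X = 1 / t + W x\<close>. Then \<open>K x\<close> is the derivative of
    \<open>a * ln X + (2 / \<omega>) * ln D(1 / X)\<close> with respect to \<open>X\<close>, and
    both partial derivatives of the defect \<open>F\<close> can be expressed through it.\<close>
  define K where "K = (\<lambda>x. fps_const a * Z x - fps_const (2 / \<omega>) * (fps_deriv H oo Z x) * (Z x)\<^sup>2)"
  define F' where "F' = (\<lambda>x. W' x * (1 - K x) - fps_const a)"

  have dW: "fps_has_deriv W W'"
    by (simp add: W_def W'_def fps_has_deriv_fps_P)
  have dXW: "fps_has_deriv (\<lambda>x. fps_X * W x) (\<lambda>x. fps_X * W' x)"
    by (intro fps_has_deriv_cmult dW)
  have dL: "fps_has_deriv \<Lambda> (\<lambda>x. Z x * W' x)"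
    using fps_has_deriv_compose[OF dXW, of "fps_ln 1"]
    by (simp add: \<Lambda>_def dln invG Z mult_ac)
  have dZ: "fps_has_deriv Z (\<lambda>x. - ((Z x)\<^sup>2 * W' x))"
  proof -
    have "fps_X * ((fps_deriv (inverse (1 + fps_X)) oo (fps_X * W x)) * (fps_X * W' x)) =
            - ((Z x)\<^sup>2 * W' x)" for x
    proof -
      have "fps_deriv (inverse (1 + fps_X)) oo (fps_X * W x) = - (inverse (G x))\<^sup>2"
        using fps_compose_power[of "fps_X * W x" "inverse (1 + fps_X)" 2]
        by (simp add: dinv invG flip: fps_compose_uminus)
      thus ?thesis unfolding Z by algebra
    qed
    thus ?thesis
      using fps_has_deriv_cmult[OF fps_has_deriv_compose[OF dXW, of "inverse (1 + fps_X)"], of fps_X]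
      unfolding Z_def by simp
  qed
  have dH: "fps_has_deriv (\<lambda>x. H oo Z x) (\<lambda>x. (fps_deriv H oo Z x) * (- ((Z x)\<^sup>2 * W' x)))"
    by (rule fps_has_deriv_compose[OF dZ]) (simp add: Z_def)
  have dx: "fps_has_deriv (\<lambda>x. fps_const (a * x)) (\<lambda>_. fps_const a)"
    by (auto simp: fps_has_deriv_def intro!: derivative_eq_intros)
  have F'_eq: "F' = (\<lambda>x. W' x - fps_const a - fps_const a * (Z x * W' x) -
      fps_const (2 / \<omega>) * ((fps_deriv H oo Z x) * (- ((Z x)\<^sup>2 * W' x))))"
    unfolding F'_def K_def by (intro ext) algebra
  have dF: "fps_has_deriv F F'"
    unfolding F'_eq F_def by (intro fps_has_deriv_diff fps_has_deriv_cmult dW dx dL dH)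

  \<comment> \<open>The operator \<open>fps_X\<^sup>2 * fps_deriv\<close> is minus the derivative in
    \<open>1 / t\<close>. Since \<open>1 / Z x\<close> is \<open>1 / t + W x\<close>, its rate of
    change in \<open>1 / t\<close> is the factor that accompanies \<open>K x\<close>.\<close>
  have Xdt: "fps_X\<^sup>2 * fps_deriv (F x) = fps_X\<^sup>2 * fps_deriv (W x) - fps_const a * fps_X
      + K x * (1 - fps_X\<^sup>2 * fps_deriv (W x))" for x
  proof -
    have dGt: "fps_deriv (G x) = W x + fps_X * fps_deriv (W x)"
      by (simp add: G_def)
    have XW: "fps_X * W x = G x - 1" by (simp add: G_def)
    have dZt: "fps_deriv (Z x) = inverse (G x) - fps_X * fps_deriv (G x) * (inverse (G x))\<^sup>2"
      unfolding Z using G0[of x] by (simp add: fps_inverse_deriv algebra_simps)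
    have XdZ: "fps_X\<^sup>2 * fps_deriv (Z x) = (Z x)\<^sup>2 * (1 - fps_X\<^sup>2 * fps_deriv (W x))"
      unfolding dZt dGt unfolding Z using GI[of x] XW by algebra
    have "fps_deriv (\<Lambda> x) = inverse (G x) * fps_deriv (G x)"
      unfolding \<Lambda>_def by (subst fps_compose_deriv) (simp_all add: dln invG G_def)
    hence XdL: "fps_X\<^sup>2 * fps_deriv (\<Lambda> x) = fps_X - Z x * (1 - fps_X\<^sup>2 * fps_deriv (W x))"
      unfolding dGt Z using GI[of x] XW by algebra
    have "fps_deriv (H oo Z x) = (fps_deriv H oo Z x) * fps_deriv (Z x)"
      by (rule fps_compose_deriv) (simp add: Z_def)
    hence XdH: "fps_X\<^sup>2 * fps_deriv (H oo Z x) =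
        (fps_deriv H oo Z x) * ((Z x)\<^sup>2 * (1 - fps_X\<^sup>2 * fps_deriv (W x)))"
      using XdZ by algebra
    have "fps_deriv (F x) = fps_deriv (W x) - fps_const a * fps_deriv (\<Lambda> x)
        - fps_const (2 / \<omega>) * fps_deriv (H oo Z x)"
      by (simp add: F_def)
    thus ?thesis unfolding K_def using XdL XdH by algebra
  qed

  have "F x = 0"
  proof (rule transport_unique[OF dF])
    \<comment> \<open>At \<open>\<xi> = 0\<close> each \<open>P n\<close> reduces to
      \<open>c n\<close>, so this is the fixpoint property of the series of constants.\<close>
    show "F 0 = 0"
      using gig_step_Abs_fps_gig_c[of lam \<omega>]
      unfolding gig_step_def F_def \<Lambda>_def H_def Z_alt [symmetric] W_def fps_P_def gig_P_eq_poly
        poly_gig_poly_at_0 a_def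
      by (simp add: diff_eq_eq add.commute)
    fix x
    have "(1 - fps_const a * fps_X) * W' x = fps_const a - fps_const a * fps_X\<^sup>2 * fps_deriv (W x)"
      using fps_P_transport[of lam \<omega> x] by (simp add: a_def W_def W'_def)
    thus "(1 - fps_const a * fps_X) * F' x = - (fps_const a * fps_X\<^sup>2 * fps_deriv (F x))"
      using Xdt[of x] unfolding F'_def by algebra
  qed
  thus ?thesis
    unfolding gig_step_def F_def \<Lambda>_def H_def Z_alt [symmetric] W_def a_def
    by (simp add: algebra_simps)
qed

section \<open>Asymptotic expansions up to logarithmic factors\<close>

text \<open>Without its first \<open>n\<close> terms the series is divisible by the
  \<open>n\<close>-th power of \<open>fps_X\<close>, and the quotient is again an expansion, hence
  bounded near 0. The filter includes the point 0 itself, since the functions substituted for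
  \<open>z\<close> later may vanish.\<close>

lemma has_fps_expansion_imp_bigo:
  fixes f :: "real \<Rightarrow> real"
  assumes "f has_fps_expansion F"
  shows "(\<lambda>z. f z - (\<Sum>i<n. F $ i * z ^ i)) \<in> O[nhds 0](\<lambda>z. z ^ n)"
proof -
  define g where "g = (\<lambda>z. f z - (\<Sum>i<n. F $ i * z ^ i))"
  define G where "G = F - (\<Sum>i<n. fps_const (F $ i) * fps_X ^ i)"
  have g: "g has_fps_expansion G"
    unfolding g_def G_def by (intro fps_expansion_intros assms)
  have G_nth: "G $ k = 0" if "k < n" for k
  proof -
    have "(\<Sum>i<n. F $ i * (if k = i then 1 else 0)) = F $ k"
      using that by (simp add: if_distrib cong: if_cong)
    thus ?thesis by (simp add: G_def fps_sum_nth)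
  qed
  have sub: "n \<le> subdegree G" if "G \<noteq> 0"
    using that G_nth by (intro subdegree_geI) auto
  show ?thesis
  proof (cases "G = 0")
    case True
    with g have "eventually (\<lambda>z. g z = 0) (nhds 0)"
      by (auto simp: has_fps_expansion_def elim: eventually_mono)
    hence "g \<in> O[nhds 0](\<lambda>z. z ^ n)"
      by (subst landau_o.big.in_cong[of _ "\<lambda>_. 0"]) auto
    thus ?thesis by (simp add: g_def)
  next
    case False
    \<comment> \<open>The value at 0 is the constant term of the shifted series, which makes the
      quotient continuous there.\<close>
    define h where "h = (\<lambda>z. if z = 0 then G $ n else g z / z ^ n)"
    have "h has_fps_expansion fps_shift n G"
      unfolding h_def by (rule has_fps_expansion_shift[OF g sub[OF False]]) simp
    hence "isCont h 0"
      using has_fps_expansion_imp_continuous by blast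
    hence "(h \<longlongrightarrow> h 0) (nhds 0)"
      by (simp add: isCont_def tendsto_at_iff_tendsto_nhds)
    hence "eventually (\<lambda>z. dist (h z) (h 0) < 1) (nhds 0)"
      by (rule tendstoD) simp
    hence ev: "eventually (\<lambda>z. \<bar>h z\<bar> \<le> \<bar>h 0\<bar> + 1) (nhds 0)"
      by eventually_elim (auto simp: dist_real_def)
    have gh: "g z = h z * z ^ n" for z
    proof (cases "z = 0")
      case True
      have "g 0 = G $ 0" using g by (auto simp: has_fps_expansion_def eval_fps_at_0 dest!: eventually_nhds_x_imp_x)
      thus ?thesis using True G_nth[of 0] by (cases n) (auto simp: h_def)
    qed (simp add: h_def)
    have "g \<in> O[nhds 0](\<lambda>z. z ^ n)"
      by (rule bigoI[of _ "\<bar>h 0\<bar> + 1"])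
         (use ev in eventually_elim, auto simp: gh abs_mult intro!: mult_right_mono)
    thus ?thesis by (simp add: g_def)
  qed
qed

lemma has_fps_expansion_ln_one_plus: "(\<lambda>z. ln (1 + z)) has_fps_expansion fps_ln (1::real)"
proof (rule has_fps_expansionI)
  have "eventually (\<lambda>z::real. z \<in> {-1<..<1}) (nhds 0)"
    by (intro eventually_nhds_in_open) auto
  thus "eventually (\<lambda>z::real. (\<lambda>n. fps_ln 1 $ n * z ^ n) sums ln (1 + z)) (nhds 0)"
  proof eventually_elim
    case (elim z)
    have "(\<lambda>n. fps_ln 1 $ n * z ^ n) = (\<lambda>n. - ((- z) ^ n) / real n)"
    proof
      fix n show "fps_ln 1 $ n * z ^ n = - ((- z) ^ n) / real n"
        by (cases n) (auto simp: fps_ln_nth power_minus[of z])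
    qed
    thus ?case using ln_series'[of z] elim by (simp add: abs_less_iff)
  qed
qed

lemma has_fps_expansion_inverse_one_plus: "(\<lambda>z. inverse (1 + z)) has_fps_expansion inverse (1 + fps_X :: real fps)"
  by (intro fps_expansion_intros) auto

text \<open>
  Everything is measured in powers of a quantity \<open>y\<close> tending to infinity, up to factors of
  subpolynomial growth such as powers of \<open>ln y\<close>.
\<close>

locale scale =
  fixes F :: "'a filter" and y :: "'a \<Rightarrow> real"
  assumes y_at_top: "filterlim y at_top F"
begin

definition slow :: "nat \<Rightarrow> ('a \<Rightarrow> real) \<Rightarrow> bool" where
  "slow m g \<longleftrightarrow> (\<forall>\<epsilon>>0. g \<in> O[F](\<lambda>x. y x powr (\<epsilon> - real m)))"

lemma y_pos: "eventually (\<lambda>x. y x > 0) F"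
  using y_at_top by (simp add: filterlim_at_top_dense)

lemma slow_mono:
  assumes "slow m g" "n \<le> m"
  shows "slow n g"
  unfolding slow_def
proof (intro allI impI)
  fix \<epsilon> :: real assume "\<epsilon> > 0"
  hence "g \<in> O[F](\<lambda>x. y x powr (\<epsilon> - real m))"
    using assms by (simp add: slow_def)
  also have "(\<lambda>z. z powr (\<epsilon> - real m)) \<in> O[at_top](\<lambda>z. z powr (\<epsilon> - real n))"
    using assms(2)
    by (intro bigoI[of _ 1] eventually_mono[OF eventually_ge_at_top[of 1]]) (auto intro: powr_mono)
  from this y_at_top have "(\<lambda>x. y x powr (\<epsilon> - real m)) \<in> O[F](\<lambda>x. y x powr (\<epsilon> - real n))"
    by (rule landau_o.big.compose)
  finally show "g \<in> O[F](\<lambda>x. y x powr (\<epsilon> - real n))" .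
qed

lemma slow_add: "slow m f \<Longrightarrow> slow m g \<Longrightarrow> slow m (\<lambda>x. f x + g x)"
  unfolding slow_def by (auto intro: sum_in_bigo)

lemma slow_bigo: "slow m g \<Longrightarrow> f \<in> O[F](g) \<Longrightarrow> slow m f"
  unfolding slow_def using landau_o.big_trans by blast

lemma slow_zero [simp]: "slow m (\<lambda>_. 0)"
  by (simp add: slow_def)

lemma slow_sum: "(\<And>i. i \<in> I \<Longrightarrow> slow m (f i)) \<Longrightarrow> slow m (\<lambda>x. \<Sum>i\<in>I. f i x)"
  by (induction I rule: infinite_finite_induct) (auto intro: slow_add)

text \<open>Each factor receives half of \<open>\<epsilon>\<close>; closure under products is the
  reason for quantifying over all \<open>\<epsilon>\<close> in \<open>slow\<close>.\<close>

lemma slow_mult: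
  assumes "slow m f" "slow n g"
  shows "slow (m + n) (\<lambda>x. f x * g x)"
  unfolding slow_def
proof (intro allI impI)
  fix \<epsilon> :: real assume "\<epsilon> > 0"
  hence "(\<lambda>x. f x * g x) \<in> O[F](\<lambda>x. y x powr (\<epsilon> / 2 - real m) * y x powr (\<epsilon> / 2 - real n))"
    using assms by (intro landau_o.big.mult) (auto simp: slow_def)
  thus "(\<lambda>x. f x * g x) \<in> O[F](\<lambda>x. y x powr (\<epsilon> - real (m + n)))"
    by (simp add: powr_add [symmetric] algebra_simps)
qed

lemma slow_const: "slow 0 (\<lambda>_. c)"
  unfolding slow_def
proof (intro allI impI)
  fix \<epsilon> :: real assume "\<epsilon> > 0"
  hence "(\<lambda>_. c) \<in> O[at_top](\<lambda>z. z powr (\<epsilon> - real 0))" by real_asymp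
  from this y_at_top show "(\<lambda>_. c) \<in> O[F](\<lambda>x. y x powr (\<epsilon> - real 0))"
    by (rule landau_o.big.compose)
qed

lemma slow_cmult: "slow m f \<Longrightarrow> slow m (\<lambda>x. c * f x)"
  using slow_mult[OF slow_const] by simp

lemma slow_ln: "slow 0 (\<lambda>x. ln (y x))"
  unfolding slow_def
proof (intro allI impI)
  fix \<epsilon> :: real assume "\<epsilon> > 0"
  hence "ln \<in> O[at_top](\<lambda>z. z powr (\<epsilon> - real 0))" by real_asymp
  from this y_at_top show "(\<lambda>x. ln (y x)) \<in> O[F](\<lambda>x. y x powr (\<epsilon> - real 0))"
    by (rule landau_o.big.compose)
qed

lemma slow_poly_ln: "slow 0 (\<lambda>x. poly p (ln (y x)))"
proof (induction p)
  case (pCons a p)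
  thus ?case using slow_add[OF slow_const[of a], of "\<lambda>x. ln (y x) * poly p (ln (y x))"] slow_mult[OF slow_ln pCons.IH]
    by simp
qed simp

lemma slow_inverse_power: "slow n (\<lambda>x. 1 / y x ^ n)"
  unfolding slow_def
proof (intro allI impI)
  fix \<epsilon> :: real assume "\<epsilon> > 0"
  hence "(\<lambda>z. 1 / z ^ n) \<in> O[at_top](\<lambda>z. z powr (\<epsilon> - real n))" by real_asymp
  from this y_at_top show "(\<lambda>x. 1 / y x ^ n) \<in> O[F](\<lambda>x. y x powr (\<epsilon> - real n))"
    by (rule landau_o.big.compose)
qed

lemma slow_div_power: "slow m f \<Longrightarrow> slow (m + n) (\<lambda>x. f x / y x ^ n)"
  using slow_mult[OF _ slow_inverse_power] by simp

lemma slow_power: "slow m f \<Longrightarrow> slow (k * m) (\<lambda>x. f x ^ k)"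
  by (induction k) (auto intro: slow_mult slow_const)

text \<open>One order must be given up, because \<open>slow n\<close> still admits logarithmic
  factors. Any \<open>\<epsilon>\<close> below 1 would do; 1/2 is taken.\<close>

lemma slow_imp_smallo:
  assumes "slow (Suc n) f"
  shows "f \<in> o[F](\<lambda>x. 1 / y x ^ n)"
proof -
  have "f \<in> O[F](\<lambda>x. y x powr (1 / 2 - real (Suc n)))"
    using assms unfolding slow_def by (auto dest!: spec[of _ "1 / 2"])
  also have "(\<lambda>z. z powr (1 / 2 - real (Suc n))) \<in> o[at_top](\<lambda>z. 1 / z ^ n)" by real_asymp
  from this y_at_top have "(\<lambda>x. y x powr (1 / 2 - real (Suc n))) \<in> o[F](\<lambda>x. 1 / y x ^ n)"
    by (rule landau_o.small.compose)
  finally show ?thesis .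
qed

lemma slow_Suc_tendsto_0: "slow (Suc 0) f \<Longrightarrow> (f \<longlongrightarrow> 0) F"
  using slow_imp_smallo[of 0 f] by (auto dest: smalloD_tendsto)

text \<open>The coefficients vary with \<open>x\<close> because they will be polynomials in
  \<open>ln (y x)\<close>. Slowness is asked of all of them, also beyond the truncation, so that
  products and compositions stay within the notion.\<close>

definition approx :: "nat \<Rightarrow> ('a \<Rightarrow> real) \<Rightarrow> ('a \<Rightarrow> real fps) \<Rightarrow> bool" where
  "approx N f A \<longleftrightarrow> (\<forall>n. slow 0 (\<lambda>x. A x $ n)) \<and> slow N (\<lambda>x. f x - (\<Sum>n<N. A x $ n / y x ^ n))"

lemma approx_cong:
  assumes "approx N f A" "\<And>n x. n < N \<Longrightarrow> A x $ n = B x $ n" "\<And>n. slow 0 (\<lambda>x. B x $ n)"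
  shows "approx N f B"
  using assms by (simp add: approx_def)

lemma approx_eventually_cong:
  assumes "approx N f A" "eventually (\<lambda>x. f x = g x) F"
  shows "approx N g A"
proof -
  have "(\<lambda>x. g x - (\<Sum>n<N. A x $ n / y x ^ n)) \<in> O[F](\<lambda>x. f x - (\<Sum>n<N. A x $ n / y x ^ n))"
    using assms(2) by (intro bigoI[of _ 1]) (auto elim!: eventually_mono)
  thus ?thesis using assms(1) slow_bigo unfolding approx_def by blast
qed

lemma approx_mono:
  assumes "approx N f A" "M \<le> N"
  shows "approx M f A"
proof -
  have "slow M (\<lambda>x. A x $ n / y x ^ n)" if "n \<ge> M" for n
    using slow_mono[of n, OF _ that] slow_div_power[of 0 "\<lambda>x. A x $ n" n] assms(1)
    by (simp add: approx_def)
  hence "slow M (\<lambda>x. (f x - (\<Sum>n<N. A x $ n / y x ^ n)) + (\<Sum>n\<in>{M..<N}. A x $ n / y x ^ n))"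
    using assms by (intro slow_add slow_sum) (auto simp: approx_def intro: slow_mono)
  moreover have "(\<Sum>n<N. A x $ n / y x ^ n) =
      (\<Sum>n<M. A x $ n / y x ^ n) + (\<Sum>n\<in>{M..<N}. A x $ n / y x ^ n)" for x
    using assms(2) by (metis (lifting) atLeast0LessThan sum.atLeastLessThan_concat le0)
  ultimately show ?thesis using assms(1) by (simp add: approx_def)
qed

lemma approx_imp_slow: "approx N f A \<Longrightarrow> slow 0 f"
  using approx_mono[of N f A 0] by (simp add: approx_def)

lemma approx_imp_slow_Suc: "approx (Suc N) f A \<Longrightarrow> (\<And>x. A x $ 0 = 0) \<Longrightarrow> slow (Suc 0) f"
  using approx_mono[of "Suc N" f A "Suc 0"] by (simp add: approx_def)

lemma approx_0I: "slow 0 f \<Longrightarrow> (\<And>n. slow 0 (\<lambda>x. A x $ n)) \<Longrightarrow> approx 0 f A"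
  by (simp add: approx_def)

lemma approx_slow_const:
  assumes "slow 0 g"
  shows "approx N g (\<lambda>x. fps_const (g x))"
proof (cases N)
  case 0
  have "slow 0 (\<lambda>x. fps_const (g x) $ n)" for n
    using assms by (cases n) auto
  thus ?thesis using assms 0 by (simp add: approx_def)
next
  case (Suc M)
  have "(\<Sum>n<N. fps_const (g x) $ n / y x ^ n) = g x" for x
    unfolding Suc by (subst sum.lessThan_Suc_shift) simp
  moreover have "slow 0 (\<lambda>x. fps_const (g x) $ n)" for n
    using assms by (cases n) auto
  ultimately show ?thesis by (simp add: approx_def)
qed

lemma approx_const: "approx N (\<lambda>_. c) (\<lambda>_. fps_const c)"
  by (rule approx_slow_const[OF slow_const])

lemma approx_add:
  assumes "approx N f A" "approx N g B"
  shows "approx N (\<lambda>x. f x + g x) (\<lambda>x. A x + B x)"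
proof -
  have "slow N (\<lambda>x. (f x - (\<Sum>n<N. A x $ n / y x ^ n)) + (g x - (\<Sum>n<N. B x $ n / y x ^ n)))"
    using assms by (intro slow_add) (auto simp: approx_def)
  thus ?thesis using assms
    by (auto simp: approx_def add_divide_distrib sum.distrib algebra_simps intro: slow_add)
qed

lemma approx_sum:
  assumes "\<And>i. i \<in> I \<Longrightarrow> approx N (f i) (A i)"
  shows "approx N (\<lambda>x. \<Sum>i\<in>I. f i x) (\<lambda>x. \<Sum>i\<in>I. A i x)"
  using assms approx_const[of N 0]
  by (induction I rule: infinite_finite_induct) (auto intro: approx_add)

lemma slow_fps_mult_nth:
  assumes "\<And>n. slow 0 (\<lambda>x. A x $ n)" "\<And>n. slow 0 (\<lambda>x. B x $ n)"
  shows "slow 0 (\<lambda>x. (A x * B x) $ n)"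
  unfolding fps_mult_nth using assms slow_mult[of 0 _ 0] by (intro slow_sum) simp

lemma approx_mult:
  assumes "approx N f A" "approx N g B"
  shows "approx N (\<lambda>x. f x * g x) (\<lambda>x. A x * B x)"
proof -
  define SA where "SA = (\<lambda>x. \<Sum>n<N. A x $ n / y x ^ n)"
  define SB where "SB = (\<lambda>x. \<Sum>n<N. B x $ n / y x ^ n)"
  have A: "slow 0 (\<lambda>x. A x $ n)" and B: "slow 0 (\<lambda>x. B x $ n)" for n
    using assms by (auto simp: approx_def)
  define T where "T = (\<lambda>(i, j) x. (A x $ i / y x ^ i) * (B x $ j / y x ^ j))"
  \<comment> \<open>The product of the two truncated sums contains terms of total order
    \<open>N\<close> or more; they belong to the remainder.\<close>
  define hi where "hi = {(i, j). i < N \<and> j < N \<and> i + j \<ge> N}"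
  have split: "SA x * SB x = (\<Sum>n<N. (A x * B x) $ n / y x ^ n) + (\<Sum>p\<in>hi. T p x)" for x
  proof -
    have "SA x * SB x = (\<Sum>p\<in>{..<N}\<times>{..<N}. T p x)"
      by (simp add: SA_def SB_def sum_product sum.cartesian_product T_def case_prod_unfold)
    also have "{..<N}\<times>{..<N} = {(i, j). i + j < N} \<union> hi" by (auto simp: hi_def)
    also have "(\<Sum>p\<in>\<dots>. T p x) = (\<Sum>p\<in>{(i, j). i + j < N}. T p x) + (\<Sum>p\<in>hi. T p x)"
    proof (rule sum.union_disjoint)
      show "finite {(i, j). i + j < N}" by (rule finite_subset[of _ "{..<N}\<times>{..<N}"]) auto
      show "finite hi" by (rule finite_subset[of _ "{..<N}\<times>{..<N}"]) (auto simp: hi_def)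
    qed (auto simp: hi_def)
    also have "(\<Sum>p\<in>{(i, j). i + j < N}. T p x) = (\<Sum>n<N. \<Sum>i\<le>n. T (i, n - i) x)"
      using sum.triangle_reindex[of "\<lambda>i j. T (i, j) x" N] by (simp add: case_prod_unfold)
    also have "\<dots> = (\<Sum>n<N. (A x * B x) $ n / y x ^ n)"
      by (intro sum.cong refl)
         (auto simp: T_def fps_mult_nth sum_divide_distrib atLeast0AtMost simp flip: power_add intro!: sum.cong)
    finally show ?thesis .
  qed
  have "slow N (T p)" if "p \<in> hi" for p
  proof -
    obtain i j where ij: "p = (i, j)" "i + j \<ge> N" using \<open>p \<in> hi\<close> by (auto simp: hi_def)
    have "slow (i + j) (T p)"
      using slow_mult[OF slow_div_power[OF A[of i], of i] slow_div_power[OF B[of j], of j]]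
      by (simp add: T_def ij)
    thus ?thesis using ij(2) by (rule slow_mono)
  qed
  hence hi: "slow N (\<lambda>x. \<Sum>p\<in>hi. T p x)" by (intro slow_sum)
  have "slow 0 SA"
    unfolding SA_def using slow_div_power[OF A]
    by (intro slow_sum) (auto intro: slow_mono)
  moreover have "slow 0 g" using assms(2) by (rule approx_imp_slow)
  moreover have "slow N (\<lambda>x. f x - SA x)" "slow N (\<lambda>x. g x - SB x)"
    using assms by (simp_all add: approx_def SA_def SB_def)
  \<comment> \<open>Replacing one factor at a time needs only that \<open>g\<close> and
    \<open>SA\<close> are slow of order 0.\<close>
  ultimately have "slow N (\<lambda>x. (f x - SA x) * g x + SA x * (g x - SB x) + (\<Sum>p\<in>hi. T p x))"
    using slow_mult[of N "\<lambda>x. f x - SA x" 0 g] slow_mult[of 0 SA N "\<lambda>x. g x - SB x"] hi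
    by (intro slow_add) auto
  also have "(\<lambda>x. (f x - SA x) * g x + SA x * (g x - SB x) + (\<Sum>p\<in>hi. T p x)) =
      (\<lambda>x. f x * g x - (\<Sum>n<N. (A x * B x) $ n / y x ^ n))"
    using split by (auto simp: algebra_simps)
  finally show ?thesis
    using slow_fps_mult_nth[OF A B] by (simp add: approx_def)
qed

lemma approx_cmult: "approx N f A \<Longrightarrow> approx N (\<lambda>x. c * f x) (\<lambda>x. fps_const c * A x)"
  by (rule approx_mult[OF approx_const])

lemma approx_power: "approx N f A \<Longrightarrow> approx N (\<lambda>x. f x ^ k) (\<lambda>x. A x ^ k)"
proof (induction k)
  case 0
  show ?case using approx_const[of N 1] by simp
qed (auto intro: approx_mult)

text \<open>The analytic counterpart of \<open>fps_eq_upto_X_mult\<close>, and the source of the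
  extra order in the bootstrapping.\<close>

lemma approx_div_y:
  assumes "approx N f A"
  shows "approx (Suc N) (\<lambda>x. f x / y x) (\<lambda>x. fps_X * A x)"
proof -
  have "slow 0 (\<lambda>x. (fps_X * A x) $ n)" for n
    using assms by (cases n) (auto simp: approx_def)
  moreover have "slow (N + 1) (\<lambda>x. (f x - (\<Sum>n<N. A x $ n / y x ^ n)) / y x ^ 1)"
    using assms by (intro slow_div_power) (simp add: approx_def)
  moreover have "(\<Sum>n<Suc N. (fps_X * A x) $ n / y x ^ n) = (\<Sum>n<N. A x $ n / y x ^ n) / y x" for x
    by (subst sum.lessThan_Suc_shift) (simp add: sum_divide_distrib mult.commute)
  ultimately show ?thesis
    by (simp add: approx_def diff_divide_distrib)
qed

text \<open>Only a truncation of the outer series at order \<open>N\<close> enters, so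
  \<open>\<Phi>\<close> may be a merely asymptotic expansion.\<close>

lemma approx_compose:
  assumes h: "approx N h B" "\<And>x. B x $ 0 = 0"
    and g: "slow N (\<lambda>x. g x - (\<Sum>i<N. \<Phi> $ i * h x ^ i))"
  shows "approx N g (\<lambda>x. \<Phi> oo B x)"
proof -
  have B: "slow 0 (\<lambda>x. (B x ^ i) $ n)" for i n
    using approx_power[OF h(1), of i] by (simp add: approx_def)
  have slow: "slow 0 (\<lambda>x. (\<Phi> oo B x) $ n)" for n
    unfolding fps_compose_nth by (intro slow_sum slow_cmult B)
  have "approx N (\<lambda>x. \<Sum>i<N. \<Phi> $ i * h x ^ i) (\<lambda>x. \<Sum>i<N. fps_const (\<Phi> $ i) * B x ^ i)"
    by (intro approx_sum approx_cmult approx_power h)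
  hence "approx N (\<lambda>x. \<Sum>i<N. \<Phi> $ i * h x ^ i) (\<lambda>x. \<Phi> oo B x)"
  proof (rule approx_cong[OF _ _ slow])
    \<comment> \<open>The power \<open>B x ^ i\<close> starts at degree \<open>i\<close> at the
      earliest, so terms with \<open>i > n\<close> do not reach coefficient
      \<open>n\<close>.\<close>
    fix n x assume "n < N"
    thus "(\<Sum>i<N. fps_const (\<Phi> $ i) * B x ^ i) $ n = (\<Phi> oo B x) $ n"
      unfolding fps_compose_nth fps_sum_nth fps_mult_left_const_nth
      using startsby_zero_power_prefix[OF h(2)[of x]]
      by (intro sum.mono_neutral_right) auto
  qed
  hence "slow N (\<lambda>x. (\<Sum>i<N. \<Phi> $ i * h x ^ i) - (\<Sum>n<N. (\<Phi> oo B x) $ n / y x ^ n))"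
    by (simp add: approx_def)
  from slow_add[OF g this] show ?thesis
    using slow by (simp add: approx_def)
qed

lemma approx_compose_bigo:
  assumes h: "approx N h B" "\<And>x. B x $ 0 = 0" "slow (Suc 0) h"
    and G: "filterlim h G F"
    and \<phi>: "(\<lambda>z. \<phi> z - (\<Sum>i<N. \<Phi> $ i * z ^ i)) \<in> O[G](\<lambda>z. z ^ N)"
  shows "approx N (\<lambda>x. \<phi> (h x)) (\<lambda>x. \<Phi> oo B x)"
proof (rule approx_compose[OF h(1,2)])
  have "(\<lambda>x. \<phi> (h x) - (\<Sum>i<N. \<Phi> $ i * h x ^ i)) \<in> O[F](\<lambda>x. h x ^ N)"
    by (rule landau_o.big.compose[OF \<phi> G])
  moreover have "slow N (\<lambda>x. h x ^ N)"
    using slow_power[OF h(3), of N] by simp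
  ultimately show "slow N (\<lambda>x. \<phi> (h x) - (\<Sum>i<N. \<Phi> $ i * h x ^ i))"
    by (rule slow_bigo[rotated])
qed

lemma approx_compose_fps_expansion:
  assumes h: "approx N h B" "\<And>x. B x $ 0 = 0" "slow (Suc 0) h"
    and "\<phi> has_fps_expansion \<Phi>"
  shows "approx N (\<lambda>x. \<phi> (h x)) (\<lambda>x. \<Phi> oo B x)"
  using has_fps_expansion_imp_bigo[OF assms(4)] slow_Suc_tendsto_0[OF h(3)]
  by (intro approx_compose_bigo[OF h]) auto

lemma approx_ln_fps_log:
  assumes f: "approx N f A" and A0: "\<And>x. A x $ 0 = a" "a > 0" and lim: "slow (Suc 0) (\<lambda>x. f x - a)"
  shows "approx N (\<lambda>x. ln (f x)) (\<lambda>x. fps_log (A x))"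
proof -
  define h where "h = (\<lambda>x. (1 / a) * (f x) + (-1))"
  have h: "approx N h (\<lambda>x. fps_const (1 / a) * A x + fps_const (-1))"
    unfolding h_def by (intro approx_add approx_cmult approx_const f)
  have h_alt: "h = (\<lambda>x. (1 / a) * (f x - a))"
    using A0(2) by (auto simp: h_def field_simps)
  have h1: "slow (Suc 0) h"
    unfolding h_alt by (intro slow_cmult lim)
  have "approx N (\<lambda>x. ln a + ln (1 + h x))
      (\<lambda>x. fps_const (ln a) + (fps_ln 1 oo (fps_const (1 / a) * A x + fps_const (-1))))"
    using A0 by (intro approx_add approx_const approx_compose_fps_expansion[OF h]
        has_fps_expansion_ln_one_plus h1) auto
  moreover have "fps_const (1 / a) * A x + fps_const (-1) = fps_const (1 / a) * A x - 1" for x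
    by (simp add: fps_eq_iff)
  ultimately have *: "approx N (\<lambda>x. ln a + ln (1 + h x)) (\<lambda>x. fps_log (A x))"
    by (simp add: fps_log_def A0)
  have "eventually (\<lambda>x. h x \<in> {-1<..}) F"
    using slow_Suc_tendsto_0[OF h1] by (rule topological_tendstoD) auto
  hence "eventually (\<lambda>x. ln a + ln (1 + h x) = ln (f x)) F"
  proof eventually_elim
    case (elim x)
    hence "ln a + ln (1 + h x) = ln (a * (1 + h x))"
      using A0(2) by (subst ln_mult) auto
    thus ?case using A0(2) by (simp add: h_def algebra_simps)
  qed
  with * show ?thesis by (rule approx_eventually_cong)
qed

end

section \<open>The distribution function and its inverse\<close>

definition gig_kernel :: "real \<Rightarrow> real \<Rightarrow> real \<Rightarrow> real" where
  "gig_kernel lam \<omega> x = x powr (lam - 1) * exp (- (\<omega> / 2) * (1 / x + x))"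

definition gig_mass :: "real \<Rightarrow> real \<Rightarrow> real \<Rightarrow> real" where
  "gig_mass lam \<omega> x = (LBINT t=0..ereal x. gig_kernel lam \<omega> t)"

definition gig_total :: "real \<Rightarrow> real \<Rightarrow> real" where
  "gig_total lam \<omega> = (LBINT t=0..\<infinity>. gig_kernel lam \<omega> t)"

lemma gig_kernel_pos: "x > 0 \<Longrightarrow> gig_kernel lam \<omega> x > 0"
  by (simp add: gig_kernel_def)

text \<open>This rests on the convention \<open>0 powr r = 0\<close>; it makes intervals closed and
  open at 0 interchangeable under the integral.\<close>

lemma gig_kernel_at_0 [simp]: "gig_kernel lam \<omega> 0 = 0"
  by (simp add: gig_kernel_def)

lemma continuous_on_gig_kernel: "0 \<notin> A \<Longrightarrow> continuous_on A (gig_kernel lam \<omega>)"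
  unfolding gig_kernel_def by (intro continuous_intros) auto

lemma isCont_gig_kernel: "x > 0 \<Longrightarrow> isCont (gig_kernel lam \<omega>) x"
  unfolding gig_kernel_def by (intro continuous_intros) auto

section \<open>Total mass of the kernel and the Bessel function\<close>

lemma cosh_ge_quarter_square: "cosh t \<ge> t\<^sup>2 / 4" for t :: real
proof -
  have "1 + \<bar>t\<bar> + \<bar>t\<bar>\<^sup>2 / 2 \<le> exp \<bar>t\<bar>"
    by (rule exp_lower_Taylor_quadratic) simp
  also have "exp \<bar>t\<bar> \<le> 2 * cosh t"
    by (cases "t \<ge> 0") (auto simp: cosh_def)
  finally show ?thesis by simp
qed

lemma set_integrable_exp_cosh:
  assumes "\<omega> > 0"
  shows "set_integrable lborel (einterval (-\<infinity>) \<infinity>) (\<lambda>t. exp (lam * t - \<omega> * cosh t))"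
proof -
  \<comment> \<open>Completing the square bounds \<open>(\<bar>lam\<bar> + 1) * \<bar>t\<bar> -
    \<omega> * t\<^sup>2 / 4\<close> by the exponent in \<open>M\<close>. The additional
    \<open>\<bar>t\<bar>\<close> pays for the denominator, as
    \<open>1 + t\<^sup>2 \<le> 2 * exp \<bar>t\<bar>\<close>, whence the factor 2.\<close>
  define M where "M = 2 * exp ((\<bar>lam\<bar> + 1)\<^sup>2 / \<omega>)"
  have pos: "1 + x\<^sup>2 > 0" for x :: real
    by (simp add: add_pos_nonneg)
  have int: "set_integrable lborel (einterval (-\<infinity>) \<infinity>) (\<lambda>t::real. 1 / (1 + t\<^sup>2))"
  proof (rule interval_integral_FTC_nonneg)
    show "DERIV arctan x :> 1 / (1 + x\<^sup>2)" for x
      using DERIV_arctan[of x] by (simp add: field_simps)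
    show "((arctan \<circ> real_of_ereal) \<longlongrightarrow> - (pi / 2)) (at_right (- \<infinity>))"
      unfolding ereal_tendsto_simps using tendsto_arctan_at_bot by simp
    show "((arctan \<circ> real_of_ereal) \<longlongrightarrow> pi / 2) (at_left \<infinity>)"
      unfolding ereal_tendsto_simps by (rule tendsto_arctan_at_top)
    show "isCont (\<lambda>t. 1 / (1 + t\<^sup>2)) x" for x :: real
      using pos[of x] by (intro continuous_intros) auto
  qed (auto simp: pos)
  have "set_integrable lborel (einterval (-\<infinity>) \<infinity>) (\<lambda>t. M * (1 / (1 + t\<^sup>2)))"
    by (intro set_integrable_mult_right int)
  thus ?thesis
  proof (rule set_integrable_bound)
    show "set_borel_measurable lborel (einterval (- \<infinity>) \<infinity>) (\<lambda>t. exp (lam * t - \<omega> * cosh t))"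
      unfolding set_borel_measurable_def
      by (intro borel_measurable_scaleR borel_measurable_indicator)
         (auto intro!: borel_measurable_continuous_onI continuous_intros)
    show "AE t in lborel. t \<in> einterval (- \<infinity>) \<infinity> \<longrightarrow>
        norm (exp (lam * t - \<omega> * cosh t)) \<le> norm (M * (1 / (1 + t\<^sup>2)))"
    proof (intro always_eventually allI impI)
      fix t :: real
      have "1 + \<bar>t\<bar> + \<bar>t\<bar>\<^sup>2 / 2 \<le> exp \<bar>t\<bar>"
        by (rule exp_lower_Taylor_quadratic) simp
      hence 1: "1 + t\<^sup>2 \<le> 2 * exp \<bar>t\<bar>" by simp
      have "lam * t \<le> \<bar>lam\<bar> * \<bar>t\<bar>"
        by (metis abs_ge_self abs_mult)
      moreover have "\<omega> * (t\<^sup>2 / 4) \<le> \<omega> * cosh t"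
        using assms cosh_ge_quarter_square[of t] by (intro mult_left_mono) auto
      moreover have "0 \<le> \<omega> * ((\<bar>lam\<bar> + 1) / \<omega> - \<bar>t\<bar> / 2)\<^sup>2"
        using assms by simp
      moreover have "\<omega> * ((\<bar>lam\<bar> + 1) / \<omega> - \<bar>t\<bar> / 2)\<^sup>2 =
          (\<bar>lam\<bar> + 1)\<^sup>2 / \<omega> - (\<bar>lam\<bar> * \<bar>t\<bar> + \<bar>t\<bar>) + \<omega> * (t\<^sup>2 / 4)"
        using assms by (simp add: power2_diff field_simps) (simp add: power2_eq_square algebra_simps)
      ultimately have "lam * t - \<omega> * cosh t + \<bar>t\<bar> \<le> (\<bar>lam\<bar> + 1)\<^sup>2 / \<omega>" by linarith
      hence "exp (lam * t - \<omega> * cosh t) * exp \<bar>t\<bar> \<le> exp ((\<bar>lam\<bar> + 1)\<^sup>2 / \<omega>)"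
        by (simp flip: exp_add)
      moreover have "exp (lam * t - \<omega> * cosh t) * (1 + t\<^sup>2) \<le>
          exp (lam * t - \<omega> * cosh t) * (2 * exp \<bar>t\<bar>)"
        by (intro mult_left_mono 1) auto
      ultimately have "exp (lam * t - \<omega> * cosh t) * (1 + t\<^sup>2) \<le> M"
        unfolding M_def by linarith
      thus "norm (exp (lam * t - \<omega> * cosh t)) \<le> norm (M * (1 / (1 + t\<^sup>2)))"
        using pos[of t] by (simp add: M_def field_simps)
    qed
  qed
qed

lemma gig_kernel_exp: "gig_kernel lam \<omega> (exp t) * exp t = exp (lam * t - \<omega> * cosh t)"
proof -
  have "gig_kernel lam \<omega> (exp t) * exp t = exp (t * (lam - 1) + (- (\<omega> / 2) * (1 / exp t + exp t)) + t)"
    unfolding gig_kernel_def exp_powr_real exp_add by simp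
  also have "1 / exp t + exp t = 2 * cosh t"
    by (simp add: cosh_def exp_minus field_simps)
  finally show ?thesis by (simp add: algebra_simps)
qed

text \<open>The substitution \<open>x = exp t\<close> leads to an integral over the whole line;
  folding it at \<open>t = 0\<close> pairs \<open>exp (lam * t)\<close> with
  \<open>exp (- lam * t)\<close> into \<open>2 * cosh (lam * t)\<close>.\<close>

lemma
  assumes "\<omega> > 0"
  shows set_integrable_gig_kernel: "set_integrable lborel {0<..} (gig_kernel lam \<omega>)"
    and gig_total_eq: "gig_total lam \<omega> = 2 * bessel_K lam \<omega>"
proof -
  define q where "q = (\<lambda>t. exp (lam * t - \<omega> * cosh t))"
  have q: "set_integrable lborel (einterval (-\<infinity>) \<infinity>) q"
    unfolding q_def by (rule set_integrable_exp_cosh[OF assms])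
  have "((\<lambda>x. ereal (exp x)) \<longlongrightarrow> ereal 0) at_bot"
    by (intro tendsto_ereal exp_at_bot)
  hence A: "((ereal \<circ> exp \<circ> real_of_ereal) \<longlongrightarrow> 0) (at_right (- \<infinity>))"
    unfolding ereal_tendsto_simps by (simp add: o_def zero_ereal_def)
  have B: "((ereal \<circ> exp \<circ> real_of_ereal) \<longlongrightarrow> \<infinity>) (at_left \<infinity>)"
    by (simp add: ereal_tendsto_simps exp_at_top)
  have int: "set_integrable lborel (einterval (-\<infinity>) \<infinity>) (\<lambda>t. gig_kernel lam \<omega> (exp t) * exp t)"
    using q by (simp add: gig_kernel_exp q_def)
  have subst: "set_integrable lborel (einterval 0 \<infinity>) (gig_kernel lam \<omega>)"
    "gig_total lam \<omega> = (LBINT t=-\<infinity>..\<infinity>. gig_kernel lam \<omega> (exp t) * exp t)"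
    unfolding gig_total_def
    by (rule interval_integral_substitution_nonneg[OF _ _ _ _ _ _ A B int];
        auto simp: isCont_gig_kernel less_imp_le[OF gig_kernel_pos])+
  have "einterval 0 \<infinity> = {0<..}" by (auto simp: einterval_def zero_ereal_def)
  with subst(1) show "set_integrable lborel {0<..} (gig_kernel lam \<omega>)" by simp
  have ii: "interval_lebesgue_integrable lborel (-\<infinity>) \<infinity> q"
    using q by (simp add: interval_lebesgue_integrable_def)
  have ii': "interval_lebesgue_integrable lborel 0 \<infinity> (\<lambda>t. exp (l * t - \<omega> * cosh t))" for l
    unfolding interval_lebesgue_integrable_def
    using set_integrable_subset[OF set_integrable_exp_cosh[OF assms, of l], of "einterval 0 \<infinity>"]
    by (auto simp: einterval_def)
  have "gig_total lam \<omega> = (LBINT t=-\<infinity>..\<infinity>. q t)"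
    by (simp add: subst(2) gig_kernel_exp q_def)
  also have "\<dots> = (LBINT t=-\<infinity>..0. q t) + (LBINT t=0..\<infinity>. q t)"
    by (rule interval_integral_sum [symmetric]) (use ii in \<open>simp add: min_def max_def\<close>)
  also have "(LBINT t=-\<infinity>..0. q t) = (LBINT t=0..\<infinity>. q (- t))"
    using interval_integral_reflect[of "-\<infinity>" 0 q] by simp
  also have "\<dots> + (LBINT t=0..\<infinity>. q t) = (LBINT t=0..\<infinity>. q (- t) + q t)"
    using ii'[of "-lam"] ii'[of lam] by (subst interval_lebesgue_integral_add) (simp_all add: q_def)
  also have "\<dots> = (LBINT t=0..\<infinity>. 2 * (exp (- \<omega> * cosh t) * cosh (lam * t)))"
  proof -
    have "q s = exp (- \<omega> * cosh s) * exp (lam * s)" for s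
      by (simp add: q_def flip: exp_add)
    hence "q (- t) + q t = 2 * (exp (- \<omega> * cosh t) * cosh (lam * t))" for t
      by (simp add: cosh_def[of "lam * t"] algebra_simps)
    thus ?thesis by simp
  qed
  also have "\<dots> = 2 * bessel_K lam \<omega>"
    by (simp add: bessel_K_def)
  finally show "gig_total lam \<omega> = 2 * bessel_K lam \<omega>" .
qed

section \<open>The mass of an initial interval as a function of its endpoint\<close>

lemma set_integrable_gig_kernel_subset:
  assumes "\<omega> > 0" "A \<in> sets borel" "A \<subseteq> {0..}"
  shows "set_integrable lborel A (gig_kernel lam \<omega>)"
proof -
  have "(\<lambda>x. indicator {0<..} x *\<^sub>R gig_kernel lam \<omega> x) = (\<lambda>x. indicator {0..} x *\<^sub>R gig_kernel lam \<omega> x)"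
  proof
    fix x :: real
    show "indicator {0<..} x *\<^sub>R gig_kernel lam \<omega> x = indicator {0..} x *\<^sub>R gig_kernel lam \<omega> x"
      by (cases "x = 0") (auto simp: indicator_def)
  qed
  hence "set_integrable lborel {0..} (gig_kernel lam \<omega>)"
    using set_integrable_gig_kernel[OF assms(1), of lam] unfolding set_integrable_def by simp
  thus ?thesis by (rule set_integrable_subset) (use assms in auto)
qed

lemma gig_mass_diff:
  assumes "\<omega> > 0" "0 \<le> x" "0 \<le> y"
  shows "gig_mass lam \<omega> y = gig_mass lam \<omega> x + (LBINT t=ereal x..ereal y. gig_kernel lam \<omega> t)"
proof -
  have "interval_lebesgue_integrable lborel 0 (ereal (max x y)) (gig_kernel lam \<omega>)"
    using assms unfolding interval_lebesgue_integrable_def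
    by (auto intro!: set_integrable_gig_kernel_subset simp: einterval_def)
  moreover have "min 0 (min (ereal x) (ereal y)) = 0" "max 0 (max (ereal x) (ereal y)) = ereal (max x y)"
    using assms by (auto simp: min_def max_def zero_ereal_def)
  ultimately show ?thesis
    unfolding gig_mass_def by (intro interval_integral_sum [symmetric]) simp
qed

lemma gig_mass_has_deriv:
  assumes "\<omega> > 0" "x > 0"
  shows "(gig_mass lam \<omega> has_real_derivative gig_kernel lam \<omega> x) (at x)"
proof -
  \<comment> \<open>A base point strictly between 0 and \<open>x\<close> keeps the fundamental
    theorem on an interval where the kernel is known to be continuous.\<close>
  define c where "c = x / 2"
  have c: "c > 0" "c < x" using assms by (auto simp: c_def)
  have "((\<lambda>u. LBINT y=ereal c..ereal u. gig_kernel lam \<omega> y) has_vector_derivative gig_kernel lam \<omega> x)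
      (at x within {c..x + 1})"
    using c by (intro interval_integral_FTC2 continuous_on_gig_kernel) auto
  hence "((\<lambda>u. LBINT y=ereal c..ereal u. gig_kernel lam \<omega> y) has_real_derivative gig_kernel lam \<omega> x)
      (at x within {c..x + 1})"
    by (simp add: has_real_derivative_iff_has_vector_derivative)
  hence "((\<lambda>u. LBINT y=ereal c..ereal u. gig_kernel lam \<omega> y) has_real_derivative gig_kernel lam \<omega> x) (at x)"
    using c by (subst (asm) at_within_interior) (auto simp: interior_atLeastAtMost_real)
  from DERIV_add[OF DERIV_const this, of "gig_mass lam \<omega> c"]
  have "((\<lambda>u. gig_mass lam \<omega> c + (LBINT y=ereal c..ereal u. gig_kernel lam \<omega> y))
      has_real_derivative gig_kernel lam \<omega> x) (at x)" by simp
  thus ?thesis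
  proof (rule DERIV_cong_ev[THEN iffD1, OF refl _ refl, rotated])
    have "eventually (\<lambda>u. u \<in> {0<..}) (nhds x)"
      using assms by (intro eventually_nhds_in_open) auto
    thus "\<forall>\<^sub>F u in nhds x. gig_mass lam \<omega> c + (LBINT y=ereal c..ereal u. gig_kernel lam \<omega> y) = gig_mass lam \<omega> u"
    proof eventually_elim
      case (elim u)
      thus ?case using gig_mass_diff[OF assms(1), of c u lam] c by simp
    qed
  qed
qed

lemma gig_mass_tendsto_total:
  assumes "\<omega> > 0"
  shows "(gig_mass lam \<omega> \<longlongrightarrow> gig_total lam \<omega>) at_top"
proof -
  have "((\<lambda>x. LBINT t:{0..x}. gig_kernel lam \<omega> t) \<longlongrightarrow> (LBINT t:{0..}. gig_kernel lam \<omega> t)) at_top"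
    using assms by (intro tendsto_set_lebesgue_integral_at_top set_integrable_gig_kernel_subset) auto
  also have "(LBINT t:{0..}. gig_kernel lam \<omega> t) = gig_total lam \<omega>"
    unfolding gig_total_def interval_lebesgue_integral_def set_lebesgue_integral_def
    by (auto intro!: Bochner_Integration.integral_cong simp: indicator_def einterval_def zero_ereal_def less_le)
  finally show ?thesis
  proof (rule Lim_transform_eventually)
    show "\<forall>\<^sub>F x in at_top. (LBINT t:{0..x}. gig_kernel lam \<omega> t) = gig_mass lam \<omega> x"
      using eventually_gt_at_top[of 0]
      by eventually_elim (auto simp: gig_mass_def zero_ereal_def interval_integral_Icc)
  qed
qed

lemma gig_mass_tendsto_0:
  assumes "\<omega> > 0"
  shows "(gig_mass lam \<omega> \<longlongrightarrow> 0) (at_right 0)"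
proof -
  have "((\<lambda>x. LBINT t:{x..1}. gig_kernel lam \<omega> t) \<longlongrightarrow> (LBINT t:{0<..1}. gig_kernel lam \<omega> t)) (at_right 0)"
    using assms by (intro tendsto_set_lebesgue_integral_at_right set_integrable_gig_kernel_subset) auto
  also have "(LBINT t:{0<..1}. gig_kernel lam \<omega> t) = gig_mass lam \<omega> 1"
    using interval_integral_Ioc[of 0 1 "gig_kernel lam \<omega>"] by (simp add: gig_mass_def zero_ereal_def)
  finally have "((\<lambda>x. gig_mass lam \<omega> 1 - (LBINT t:{x..1}. gig_kernel lam \<omega> t)) \<longlongrightarrow>
      gig_mass lam \<omega> 1 - gig_mass lam \<omega> 1) (at_right 0)"
    by (intro tendsto_intros)
  hence "((\<lambda>x. gig_mass lam \<omega> 1 - (LBINT t:{x..1}. gig_kernel lam \<omega> t)) \<longlongrightarrow> 0) (at_right 0)"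
    by simp
  thus ?thesis
  proof (rule Lim_transform_eventually)
    have "eventually (\<lambda>x::real. x \<in> {0<..<1}) (at_right 0)"
      by (intro eventually_at_right_real) auto
    thus "\<forall>\<^sub>F x in at_right 0. gig_mass lam \<omega> 1 - (LBINT t:{x..1}. gig_kernel lam \<omega> t) = gig_mass lam \<omega> x"
    proof eventually_elim
      case (elim x)
      thus ?case using gig_mass_diff[OF assms, of x 1 lam]
        by (simp add: interval_integral_Icc)
    qed
  qed
qed

lemma gig_mass_strict_mono:
  assumes "\<omega> > 0" "0 < x" "x < y"
  shows "gig_mass lam \<omega> x < gig_mass lam \<omega> y"
  using assms(2,3)
  by (intro DERIV_pos_imp_increasing[OF assms(3)])
     (use assms gig_mass_has_deriv gig_kernel_pos in \<open>meson less_le_trans\<close>)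

text \<open>The limit at 0 yields only a weak inequality; it is applied at \<open>x / 2\<close>, and
  strict monotonicity up to \<open>x\<close> makes it strict.\<close>

lemma gig_mass_pos:
  assumes "\<omega> > 0" "x > 0"
  shows "gig_mass lam \<omega> x > 0"
proof -
  have "0 \<le> gig_mass lam \<omega> (x / 2)"
  proof (rule tendsto_upperbound[OF gig_mass_tendsto_0[OF assms(1)]])
    have "eventually (\<lambda>z::real. z \<in> {0<..<x/2}) (at_right 0)"
      using assms by (intro eventually_at_right_real) auto
    thus "\<forall>\<^sub>F z in at_right 0. gig_mass lam \<omega> z \<le> gig_mass lam \<omega> (x / 2)"
      by eventually_elim (auto intro!: less_imp_le gig_mass_strict_mono assms)
  qed auto
  also have "\<dots> < gig_mass lam \<omega> x"
    using assms by (intro gig_mass_strict_mono) auto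
  finally show ?thesis .
qed

lemma gig_mass_less_total:
  assumes "\<omega> > 0" "x > 0"
  shows "gig_mass lam \<omega> x < gig_total lam \<omega>"
proof -
  have "gig_mass lam \<omega> x < gig_mass lam \<omega> (x + 1)"
    using assms by (intro gig_mass_strict_mono) auto
  also have "\<dots> \<le> gig_total lam \<omega>"
  proof (rule tendsto_lowerbound[OF gig_mass_tendsto_total[OF assms(1)]])
    show "\<forall>\<^sub>F z in at_top. gig_mass lam \<omega> (x + 1) \<le> gig_mass lam \<omega> z"
      using eventually_gt_at_top[of "x + 1"]
      by eventually_elim (use assms in \<open>auto intro!: less_imp_le gig_mass_strict_mono\<close>)
  qed auto
  finally show ?thesis .
qed

lemma bessel_K_pos:
  assumes "\<omega> > 0"
  shows "bessel_K lam \<omega> > 0"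
  using gig_mass_pos[OF assms, of 1 lam] gig_mass_less_total[OF assms, of 1 lam] gig_total_eq[OF assms]
  by simp

lemma bessel_K_minus: "bessel_K (- lam) \<omega> = bessel_K lam \<omega>"
  by (simp add: bessel_K_def)

section \<open>Normalization and the quantile function\<close>

lemma gig_cdf_eq:
  "gig_cdf lam \<omega> x = gig_mass lam \<omega> x / (2 * bessel_K lam \<omega>)"
proof -
  have "gig_cdf lam \<omega> x = (LBINT t=0..ereal x. 1 / (2 * bessel_K lam \<omega>) * gig_kernel lam \<omega> t)"
    by (simp add: gig_cdf_def gig_density_def [abs_def] gig_kernel_def mult_ac)
  thus ?thesis by (simp only: interval_lebesgue_integral_mult_right gig_mass_def) simp
qed

lemma gig_cdf_strict_mono:
  assumes "\<omega> > 0" "0 < x" "x < y"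
  shows "gig_cdf lam \<omega> x < gig_cdf lam \<omega> y"
  using gig_mass_strict_mono[OF assms] bessel_K_pos[OF assms(1)]
  by (simp add: gig_cdf_eq divide_strict_right_mono)

lemma bij_betw_gig_cdf:
  assumes "\<omega> > 0"
  shows "bij_betw (gig_cdf lam \<omega>) {0<..} {0<..<1}"
  unfolding bij_betw_def
proof
  show "inj_on (gig_cdf lam \<omega>) {0<..}"
    using gig_cdf_strict_mono[OF assms]
    by (intro linorder_inj_onI') (metis greaterThan_iff less_irrefl)
  show "gig_cdf lam \<omega> ` {0<..} = {0<..<1}"
  proof (intro equalityI subsetI)
    fix u assume "u \<in> gig_cdf lam \<omega> ` {0<..}"
    thus "u \<in> {0<..<1}"
      using gig_mass_pos[OF assms] gig_mass_less_total[OF assms] bessel_K_pos[OF assms, of lam]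
      by (auto simp: gig_cdf_eq gig_total_eq[OF assms])
  next
    fix u :: real assume u: "u \<in> {0<..<1}"
    define v where "v = u * (2 * bessel_K lam \<omega>)"
    have v: "v > 0" "v < gig_total lam \<omega>"
      using u bessel_K_pos[OF assms, of lam] by (auto simp: v_def gig_total_eq[OF assms])
    have "eventually (\<lambda>x. x > 0 \<and> gig_mass lam \<omega> x < v) (at_right 0)"
      using order_tendstoD(2)[OF gig_mass_tendsto_0[OF assms] v(1)]
      by (intro eventually_conj eventually_at_right_less)
    then obtain a where a: "a > 0" "gig_mass lam \<omega> a < v"
      using eventually_happens[of _ "at_right (0::real)"] by force
    have "eventually (\<lambda>x. x > a \<and> gig_mass lam \<omega> x > v) at_top"
      using order_tendstoD(1)[OF gig_mass_tendsto_total[OF assms] v(2)]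
      by (intro eventually_conj eventually_gt_at_top)
    then obtain b where b: "b > a" "gig_mass lam \<omega> b > v"
      using eventually_happens[of _ "at_top :: real filter"] by force
    have "\<exists>x. a \<le> x \<and> x \<le> b \<and> gig_mass lam \<omega> x = v"
    proof (rule IVT)
      show "\<forall>x. a \<le> x \<and> x \<le> b \<longrightarrow> isCont (gig_mass lam \<omega>) x"
        using gig_mass_has_deriv[OF assms] a DERIV_isCont less_le_trans by blast
    qed (use a b in auto)
    then obtain x where "a \<le> x" "gig_mass lam \<omega> x = v" by blast
    hence "x \<in> {0<..}" "gig_cdf lam \<omega> x = u"
      using a bessel_K_pos[OF assms, of lam] by (auto simp: gig_cdf_eq v_def)
    thus "u \<in> gig_cdf lam \<omega> ` {0<..}" by blast
  qed
qed

lemma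
  assumes "\<omega> > 0" "0 < u" "u < 1"
  shows gig_quantile_pos: "gig_quantile lam \<omega> u > 0"
    and gig_cdf_quantile: "gig_cdf lam \<omega> (gig_quantile lam \<omega> u) = u"
proof -
  have "u \<in> gig_cdf lam \<omega> ` {0<..}"
    using bij_betw_gig_cdf[OF assms(1), of lam] assms by (simp add: bij_betw_def)
  thus "gig_quantile lam \<omega> u > 0" "gig_cdf lam \<omega> (gig_quantile lam \<omega> u) = u"
    using inv_into_into[of u "gig_cdf lam \<omega>" "{0<..}"] f_inv_into_f[of u "gig_cdf lam \<omega>" "{0<..}"]
    by (auto simp: gig_quantile_def)
qed

lemma gig_quantile_eqI:
  assumes "\<omega> > 0" "x > 0" "gig_cdf lam \<omega> x = u"
  shows "gig_quantile lam \<omega> u = x"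
  using bij_betw_gig_cdf[OF assms(1), of lam] assms(2,3)
  unfolding gig_quantile_def bij_betw_def by (metis greaterThan_iff inv_into_f_f)

section \<open>Reflection: the reciprocal exchanges the parameters \<open>lam\<close> and
  \<open>- lam\<close>\<close>

lemma gig_mass_reflect:
  assumes "\<omega> > 0" "x > 0"
  shows "gig_mass lam \<omega> x + gig_mass (- lam) \<omega> (1 / x) = gig_total lam \<omega>"
proof -
  \<comment> \<open>The map \<open>t \<mapsto> 1 / t\<close> carries one kernel into the other, so
    the derivatives of the two summands cancel. The constant value is read off at infinity, where
    the second summand tends to 0.\<close>
  define f where "f = (\<lambda>x. gig_mass lam \<omega> x + gig_mass (- lam) \<omega> (1 / x))"
  have kernel: "gig_kernel (- lam) \<omega> (1 / t) * (1 / t\<^sup>2) = gig_kernel lam \<omega> t" if "t > 0" for t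
  proof -
    have "(1 / t) powr (- lam - 1) * (1 / t\<^sup>2) = t powr (lam - 1)"
      using that by (simp add: powr_divide powr_minus powr_diff powr_add field_simps power2_eq_square)
    thus ?thesis using that by (simp add: gig_kernel_def field_simps)
  qed
  have deriv: "(f has_real_derivative 0) (at t)" if "t > 0" for t
  proof -
    have inv: "((\<lambda>x. 1 / x) has_real_derivative - (1 / t\<^sup>2)) (at t)"
      using that by (auto intro!: derivative_eq_intros simp: power2_eq_square)
    have "(gig_mass (- lam) \<omega> has_real_derivative gig_kernel (- lam) \<omega> (1 / t)) (at (1 / t))"
      using that by (intro gig_mass_has_deriv assms) auto
    from DERIV_chain2[OF this inv] DERIV_add[OF gig_mass_has_deriv[OF assms(1) that, of lam]]
    show ?thesis unfolding f_def using kernel[OF that] by fastforce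
  qed
  have const: "f t = f x" if "t > 0" for t
  proof -
    have "\<exists>c. \<forall>t\<in>{0<..}. f t = c"
      by (rule has_field_derivative_zero_constant) (auto simp: convex_real_interval intro: has_field_derivative_at_within deriv)
    thus ?thesis using that assms(2) by auto
  qed
  have "(f \<longlongrightarrow> gig_total lam \<omega> + 0) at_top"
    unfolding f_def
  proof (intro tendsto_add gig_mass_tendsto_total assms filterlim_compose[OF gig_mass_tendsto_0[OF assms(1)]])
    show "filterlim (\<lambda>x::real. 1 / x) (at_right 0) at_top" by real_asymp
  qed
  moreover have "(f \<longlongrightarrow> f x) at_top"
    by (rule tendsto_eventually, rule eventually_mono[OF eventually_gt_at_top[of 0]]) (rule const)
  ultimately have "f x = gig_total lam \<omega> + 0"
    using tendsto_unique trivial_limit_at_top_linorder by blast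
  thus ?thesis by (simp add: f_def)
qed

lemma gig_quantile_reflect:
  assumes "\<omega> > 0" "0 < u" "u < 1"
  shows "gig_quantile lam \<omega> u = 1 / gig_quantile (- lam) \<omega> (1 - u)"
proof (rule gig_quantile_eqI[OF assms(1)])
  define q where "q = gig_quantile (- lam) \<omega> (1 - u)"
  have q: "q > 0" "gig_cdf (- lam) \<omega> q = 1 - u"
    using assms gig_quantile_pos[of \<omega> "1 - u" "-lam"] gig_cdf_quantile[of \<omega> "1 - u" "-lam"]
    by (auto simp: q_def)
  thus "1 / gig_quantile (- lam) \<omega> (1 - u) > 0" by (simp add: q_def)
  have "gig_cdf lam \<omega> (1 / q) = 1 - gig_cdf (- lam) \<omega> q"
    using gig_mass_reflect[OF assms(1), of "1 / q" lam] q bessel_K_pos[OF assms(1), of lam]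
    by (simp add: gig_cdf_eq bessel_K_minus gig_total_eq[OF assms(1)] field_simps)
  thus "gig_cdf lam \<omega> (1 / gig_quantile (- lam) \<omega> (1 - u)) = u"
    using q by (simp add: q_def)
qed

section \<open>The tail of the distribution\<close>

lemma gig_b_0: "gig_b lam \<omega> 0 = 2 / \<omega>"
  by (simp add: gig_b_def power_int_minus)

text \<open>This is what comparing powers of \<open>1 / x\<close> demands if a sum of
  \<open>b k * gig_scale lam \<omega> k x\<close> is to have derivative
  \<open>- gig_kernel lam \<omega> x\<close>. Summand \<open>j + 1\<close> of
  \<open>b (k + 1)\<close> is a multiple of summand \<open>j\<close> of \<open>b k\<close>, and
  summand 0 is a Taylor coefficient of the exponential.\<close>

lemma gig_b_Suc:
  assumes "\<omega> \<noteq> 0"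
  shows "\<omega> / 2 * gig_b lam \<omega> (Suc k) =
           (lam - real (Suc k)) * gig_b lam \<omega> k + (- (\<omega> / 2)) ^ Suc k / fact (Suc k)"
proof -
  define e where "e = (\<lambda>k j. (-1) ^ (k - j) / fact (k - j) * (\<omega> / 2) powi (int k - 2 * int j - 1)
               * (\<Prod>i<j. lam - real k + real i) :: real)"
  have shift: "\<omega> / 2 * e (Suc k) (Suc j) = (lam - real (Suc k)) * e k j" for j
  proof -
    have "(\<Prod>i<Suc j. lam - real (Suc k) + real i) = (lam - real (Suc k)) * (\<Prod>i<j. lam - real k + real i)"
      by (subst prod.lessThan_Suc_shift) (simp add: algebra_simps)
    moreover have "\<omega> / 2 * (\<omega> / 2) powi (int (Suc k) - 2 * int (Suc j) - 1) = (\<omega> / 2) powi (int k - 2 * int j - 1)"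
    proof -
      have "\<omega> / 2 * (\<omega> / 2) powi (int (Suc k) - 2 * int (Suc j) - 1) =
          (\<omega> / 2) powi (1 + (int (Suc k) - 2 * int (Suc j) - 1))"
        using assms by (subst power_int_add) auto
      thus ?thesis by simp
    qed
    moreover have "\<omega> / 2 * e (Suc k) (Suc j) = (-1) ^ (k - j) / fact (k - j)
        * (\<omega> / 2 * (\<omega> / 2) powi (int (Suc k) - 2 * int (Suc j) - 1))
        * (\<Prod>i<Suc j. lam - real (Suc k) + real i)"
      unfolding e_def diff_Suc_Suc by (simp only: mult_ac)
    ultimately have "\<omega> / 2 * e (Suc k) (Suc j) = (-1) ^ (k - j) / fact (k - j)
        * (\<omega> / 2) powi (int k - 2 * int j - 1)
        * ((lam - real (Suc k)) * (\<Prod>i<j. lam - real k + real i))"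
      by (simp only:)
    thus ?thesis unfolding e_def by (simp only: mult_ac)
  qed
  have zero: "\<omega> / 2 * e (Suc k) 0 = (- (\<omega> / 2)) ^ Suc k / fact (Suc k)"
    by (simp add: e_def power_minus[of "\<omega> / 2"] del: fact_Suc)
  have "gig_b lam \<omega> (Suc k) = (\<Sum>j\<le>Suc k. e (Suc k) j)"
    by (simp only: gig_b_def e_def)
  hence "\<omega> / 2 * gig_b lam \<omega> (Suc k) = \<omega> / 2 * e (Suc k) 0 + (\<Sum>j\<le>k. \<omega> / 2 * e (Suc k) (Suc j))"
    by (simp only: sum.atMost_Suc_shift distrib_left sum_distrib_left)
  also have "(\<Sum>j\<le>k. \<omega> / 2 * e (Suc k) (Suc j)) = (\<Sum>j\<le>k. (lam - real (Suc k)) * e k j)"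
    by (simp only: shift)
  also have "\<dots> = (lam - real (Suc k)) * gig_b lam \<omega> k"
    by (simp only: gig_b_def e_def sum_distrib_left)
  finally show ?thesis by (simp only: zero add.commute)
qed

lemma gig_c_0:
  assumes "\<omega> > 0"
  shows "gig_c lam \<omega> 0 = 2 / \<omega> * ln (2 / \<omega>)"
proof -
  have "gig_c lam \<omega> 0 = gig_step lam \<omega> 0 (Abs_fps (gig_c lam \<omega>)) $ 0"
    by (simp add: gig_step_Abs_fps_gig_c)
  also have "\<dots> = 2 / \<omega> * ln (2 / \<omega>)"
    by (simp add: gig_step_def fps_log_def gig_D_def gig_b_0)
  finally show ?thesis .
qed

text \<open>Coefficient 1 of the fixpoint equation: \<open>log (1 + t * U)\<close> contributes
  \<open>c 0\<close>, and \<open>log D\<close> contributes \<open>b 1 / b 0\<close>.\<close>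

lemma gig_c_1:
  assumes "\<omega> > 0"
  shows "gig_c lam \<omega> 1 = (4 * lam - \<omega>\<^sup>2 - 4 + 4 * (lam - 1) * ln (2 / \<omega>)) / \<omega>\<^sup>2"
proof -
  have compose_1: "(G oo B) $ Suc 0 = G $ Suc 0 * B $ Suc 0" for G B :: "real fps"
    by (simp add: fps_compose_nth)
  have "\<omega> / 2 * gig_b lam \<omega> (Suc 0) = (lam - 1) * (2 / \<omega>) - \<omega> / 2"
    using gig_b_Suc[of \<omega> lam 0] assms by (simp add: gig_b_0)
  hence b1: "gig_b lam \<omega> (Suc 0) = 4 * (lam - 1) / \<omega>\<^sup>2 - 1"
    using assms by (simp add: field_simps power2_eq_square)
  have "gig_c lam \<omega> 1 = gig_step lam \<omega> 0 (Abs_fps (gig_c lam \<omega>)) $ Suc 0"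
    by (simp add: gig_step_Abs_fps_gig_c)
  also have "\<dots> = 2 * (lam - 1) / \<omega> * gig_c lam \<omega> 0 + 2 / \<omega> * (gig_b lam \<omega> (Suc 0) / (2 / \<omega>))"
    unfolding gig_step_def fps_X_div_one_plus_X_mult
    by (simp add: compose_1 fps_log_def gig_D_def gig_b_0 fps_ln_nth)
  also have "\<dots> = (4 * lam - \<omega>\<^sup>2 - 4 + 4 * (lam - 1) * ln (2 / \<omega>)) / \<omega>\<^sup>2"
    using assms by (simp add: b1 gig_c_0 field_simps power2_eq_square)
  finally show ?thesis .
qed

section \<open>Asymptotic expansion of the tail integral\<close>

definition gig_tail :: "real \<Rightarrow> real \<Rightarrow> real \<Rightarrow> real" where
  "gig_tail lam \<omega> x = gig_total lam \<omega> - gig_mass lam \<omega> x"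

definition gig_scale :: "real \<Rightarrow> real \<Rightarrow> nat \<Rightarrow> real \<Rightarrow> real" where
  "gig_scale lam \<omega> n x = exp (- (\<omega> / 2) * x) * x powr (lam - 1 - real n)"

lemma gig_scale_pos: "x > 0 \<Longrightarrow> gig_scale lam \<omega> n x > 0"
  by (simp add: gig_scale_def)

lemma gig_scale_eq_div_power: "x > 0 \<Longrightarrow> gig_scale lam \<omega> n x = gig_scale lam \<omega> 0 x * (1 / x) ^ n"
  by (simp add: gig_scale_def powr_diff powr_realpow power_divide)

lemma gig_scale_tendsto_0: "\<omega> > 0 \<Longrightarrow> (gig_scale lam \<omega> n \<longlongrightarrow> 0) at_top"
  unfolding gig_scale_def by real_asymp

lemma gig_scale_has_deriv:
  assumes "x > 0"
  shows "(gig_scale lam \<omega> n has_real_derivative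
           gig_scale lam \<omega> n x * (- (\<omega> / 2) + (lam - 1 - real n) / x)) (at x)"
proof -
  define r where "r = lam - 1 - real n"
  have "((\<lambda>x. x powr r) has_real_derivative r * x powr (r - 1)) (at x)"
    by (rule has_real_derivative_powr[OF assms])
  moreover have "x powr (r - 1) = x powr r / x"
    using assms by (simp add: powr_diff)
  ultimately have powr: "((\<lambda>x. x powr r) has_real_derivative r * (x powr r / x)) (at x)"
    by simp
  show ?thesis
    unfolding gig_scale_def r_def [symmetric]
    by (rule derivative_eq_intros powr refl | simp add: algebra_simps)+
qed

text \<open>For \<open>z = 1 / x\<close> the left side is minus the derivative of the truncated tail
  expansion, divided by \<open>gig_scale lam \<omega> 0 x\<close>. The recurrence cancels all but a
  Taylor polynomial of the exponential and one boundary term.\<close>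

lemma sum_gig_b_telescope:
  assumes "\<omega> \<noteq> 0"
  shows "(\<Sum>i<n. gig_b lam \<omega> i * z ^ i * (\<omega> / 2 - (lam - 1 - real i) * z)) =
    (\<Sum>i<n. (- (\<omega> / 2)) ^ i / fact i * z ^ i)
      - (if n = 0 then 0 else (lam - real n) * gig_b lam \<omega> (n - 1) * z ^ n)"
proof (induction n)
  case (Suc n)
  have "\<omega> / 2 * gig_b lam \<omega> n = (if n = 0 then 0 else (lam - real n) * gig_b lam \<omega> (n - 1)) +
      (- (\<omega> / 2)) ^ n / fact n"
    using gig_b_Suc[OF assms, of lam "n - 1"] assms by (cases n) (auto simp: gig_b_0 simp del: fact_Suc)
  hence "\<omega> / 2 * gig_b lam \<omega> n * z ^ n =
      (if n = 0 then 0 else (lam - real n) * gig_b lam \<omega> (n - 1) * z ^ n) + (- (\<omega> / 2)) ^ n / fact n * z ^ n"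
    by (simp only: distrib_right) simp
  moreover have "(lam - real (Suc n)) * gig_b lam \<omega> (Suc n - 1) * z ^ Suc n =
      (lam - 1 - real n) * gig_b lam \<omega> n * z ^ n * z"
    by (simp add: algebra_simps)
  ultimately show ?case
    unfolding sum.lessThan_Suc Suc.IH by (simp add: algebra_simps)
qed simp

lemma nonneg_if_deriv_nonpos_tendsto_0:
  fixes f f' :: "real \<Rightarrow> real"
  assumes "\<And>x. x \<ge> a \<Longrightarrow> (f has_real_derivative f' x) (at x)" "\<And>x. x \<ge> a \<Longrightarrow> f' x \<le> 0"
    and "(f \<longlongrightarrow> 0) at_top" "x \<ge> a"
  shows "f x \<ge> 0"
proof (rule tendsto_upperbound[OF assms(3)])
  show "\<forall>\<^sub>F z in at_top. f z \<le> f x"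
    using eventually_ge_at_top[of x]
  proof eventually_elim
    case (elim z)
    thus ?case using assms(1,2,4)
      by (intro DERIV_nonpos_imp_nonincreasing[OF elim]) (meson order_trans)
  qed
qed auto

text \<open>Both \<open>C * g + f\<close> and \<open>C * g - f\<close> are eventually nonincreasing
  with limit 0, hence nonnegative. This takes the place of repeated integration by parts.\<close>

lemma bigo_if_deriv_bounded:
  fixes f g f' g' :: "real \<Rightarrow> real"
  assumes f: "eventually (\<lambda>x. (f has_real_derivative f' x) (at x)) at_top" "(f \<longlongrightarrow> 0) at_top"
    and g: "eventually (\<lambda>x. (g has_real_derivative g' x) (at x)) at_top" "(g \<longlongrightarrow> 0) at_top"
    and bound: "eventually (\<lambda>x. \<bar>f' x\<bar> \<le> - (C * g' x)) at_top"
  shows "f \<in> O[at_top](g)"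
proof -
  obtain a where a: "\<And>x. x \<ge> a \<Longrightarrow> (f has_real_derivative f' x) (at x)"
    "\<And>x. x \<ge> a \<Longrightarrow> (g has_real_derivative g' x) (at x)" "\<And>x. x \<ge> a \<Longrightarrow> \<bar>f' x\<bar> \<le> - (C * g' x)"
    using eventually_conj[OF f(1) eventually_conj[OF g(1) bound]] by (auto simp: eventually_at_top_linorder)
  have "\<bar>f x\<bar> \<le> C * g x" if "x \<ge> a" for x
  proof -
    have "C * g x - f x \<ge> 0"
    proof (rule nonneg_if_deriv_nonpos_tendsto_0[OF _ _ _ that])
      show "((\<lambda>x. C * g x - f x) has_real_derivative C * g' z - f' z) (at z)" if "z \<ge> a" for z
        using a(1,2)[OF that] by (auto intro!: derivative_eq_intros)
      show "C * g' z - f' z \<le> 0" if "z \<ge> a" for z using a(3)[OF that] by linarith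
      show "((\<lambda>x. C * g x - f x) \<longlongrightarrow> 0) at_top" by (rule tendsto_eq_intros f g refl | simp)+
    qed
    moreover have "C * g x + f x \<ge> 0"
    proof (rule nonneg_if_deriv_nonpos_tendsto_0[OF _ _ _ that])
      show "((\<lambda>x. C * g x + f x) has_real_derivative C * g' z + f' z) (at z)" if "z \<ge> a" for z
        using a(1,2)[OF that] by (auto intro!: derivative_eq_intros)
      show "C * g' z + f' z \<le> 0" if "z \<ge> a" for z using a(3)[OF that] by linarith
      show "((\<lambda>x. C * g x + f x) \<longlongrightarrow> 0) at_top" by (rule tendsto_eq_intros f g refl | simp)+
    qed
    ultimately show ?thesis by linarith
  qed
  moreover have "C * t \<le> \<bar>C\<bar> * \<bar>t\<bar>" for t by (metis abs_ge_self abs_mult)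
  ultimately have "\<bar>f x\<bar> \<le> \<bar>C\<bar> * \<bar>g x\<bar>" if "x \<ge> a" for x
    using that order_trans by blast
  thus ?thesis
    by (intro bigoI[of _ "\<bar>C\<bar>"] eventually_mono[OF eventually_ge_at_top[of a]]) auto
qed

lemma gig_tail_bigo:
  assumes "\<omega> > 0"
  shows "(\<lambda>x. gig_tail lam \<omega> x - (\<Sum>i<n. gig_b lam \<omega> i * gig_scale lam \<omega> i x)) \<in> O[at_top](gig_scale lam \<omega> n)"
proof -
  define r where "r = (if n = 0 then 0 else (lam - real n) * gig_b lam \<omega> (n - 1))"
  define S' where "S' = (\<lambda>x. \<Sum>i<n. gig_b lam \<omega> i *
    (gig_scale lam \<omega> i x * (- (\<omega> / 2) + (lam - 1 - real i) / x)))"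
  define R where "R = (\<lambda>z. exp (- (\<omega> / 2) * z) - (\<Sum>i<n. (- (\<omega> / 2)) ^ i / fact i * z ^ i))"
  have "(\<lambda>z. exp (- (\<omega> / 2) * z) - (\<Sum>i<n. fps_exp (- (\<omega> / 2)) $ i * z ^ i)) \<in> O[nhds 0](\<lambda>z. z ^ n)"
    by (rule has_fps_expansion_imp_bigo[OF has_fps_expansion_exp])
  hence "R \<in> O[nhds 0](\<lambda>z. z ^ n)"
    by (simp add: R_def)
  moreover have "filterlim (\<lambda>x::real. 1 / x) (nhds 0) at_top" by real_asymp
  ultimately have "(\<lambda>x. R (1 / x)) \<in> O[at_top](\<lambda>x. (1 / x) ^ n)"
    by (rule landau_o.big.compose)
  then obtain C where C: "eventually (\<lambda>x. norm (R (1 / x)) \<le> C * norm ((1 / x) ^ n)) at_top"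
    using landau_o.bigE by blast
  have T: "(gig_tail lam \<omega> has_real_derivative - gig_kernel lam \<omega> x) (at x)" if "x > 0" for x
    using DERIV_diff[OF DERIV_const gig_mass_has_deriv[OF assms that, of lam], of "gig_total lam \<omega>"]
    unfolding gig_tail_def [abs_def] by simp
  show ?thesis
  proof (rule bigo_if_deriv_bounded)
    show "\<forall>\<^sub>F x in at_top. ((\<lambda>x. gig_tail lam \<omega> x - (\<Sum>i<n. gig_b lam \<omega> i * gig_scale lam \<omega> i x))
        has_real_derivative - gig_kernel lam \<omega> x - S' x) (at x)"
      using eventually_gt_at_top[of 0]
      by eventually_elim
         (unfold S'_def, intro DERIV_diff T DERIV_sum DERIV_cmult gig_scale_has_deriv)
    show "\<forall>\<^sub>F x in at_top. (gig_scale lam \<omega> n has_real_derivative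
        gig_scale lam \<omega> n x * (- (\<omega> / 2) + (lam - 1 - real n) / x)) (at x)"
      using eventually_gt_at_top[of 0] by eventually_elim (rule gig_scale_has_deriv)
    show "((\<lambda>x. gig_tail lam \<omega> x - (\<Sum>i<n. gig_b lam \<omega> i * gig_scale lam \<omega> i x)) \<longlongrightarrow> 0) at_top"
    proof -
      have "((\<lambda>x. (gig_total lam \<omega> - gig_mass lam \<omega> x) - (\<Sum>i<n. gig_b lam \<omega> i * gig_scale lam \<omega> i x)) \<longlongrightarrow>
          (gig_total lam \<omega> - gig_total lam \<omega>) - (\<Sum>i<n. gig_b lam \<omega> i * 0)) at_top"
        by (intro tendsto_intros gig_mass_tendsto_total gig_scale_tendsto_0 assms)
      thus ?thesis by (simp add: gig_tail_def)
    qed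
    show "(gig_scale lam \<omega> n \<longlongrightarrow> 0) at_top" by (rule gig_scale_tendsto_0[OF assms])
    have "((\<lambda>x. (lam - 1 - real n) / x) \<longlongrightarrow> 0) at_top" by real_asymp
    \<comment> \<open>The scale decays at rate \<open>\<omega> / 2\<close> up to a correction of
      order \<open>1 / x\<close>. From here on at least \<open>\<omega> / 4\<close> of that rate
      remains, whence the factor \<open>4 / \<omega>\<close> in the comparison constant.\<close>
    hence "eventually (\<lambda>x. (lam - 1 - real n) / x < \<omega> / 4) at_top"
      using assms by (intro order_tendstoD(2)[of _ 0]) auto
    thus "\<forall>\<^sub>F x in at_top. \<bar>- gig_kernel lam \<omega> x - S' x\<bar> \<le>
        - (4 * (C + \<bar>r\<bar>) / \<omega> * (gig_scale lam \<omega> n x * (- (\<omega> / 2) + (lam - 1 - real n) / x)))"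
      using eventually_gt_at_top[of 0] C
    proof eventually_elim
      case (elim x)
      define E where "E = gig_scale lam \<omega> 0 x"
      have E: "E > 0" using elim by (simp add: E_def gig_scale_pos)
      have kernel: "gig_kernel lam \<omega> x = E * exp (- (\<omega> / 2) * (1 / x))"
      proof -
        have "exp (- (\<omega> / 2) * (1 / x + x)) = exp (- (\<omega> / 2) * (1 / x)) * exp (- (\<omega> / 2) * x)"
          by (simp only: distrib_left exp_add)
        thus ?thesis by (simp add: gig_kernel_def E_def gig_scale_def)
      qed
      have "- S' x = E * (\<Sum>i<n. gig_b lam \<omega> i * (1 / x) ^ i * (\<omega> / 2 - (lam - 1 - real i) * (1 / x)))"
        unfolding S'_def sum_distrib_left sum_negf [symmetric] E_def
      proof (intro sum.cong refl)
        fix i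
        show "- (gig_b lam \<omega> i * (gig_scale lam \<omega> i x * (- (\<omega> / 2) + (lam - 1 - real i) / x))) =
          gig_scale lam \<omega> 0 x * (gig_b lam \<omega> i * (1 / x) ^ i * (\<omega> / 2 - (lam - 1 - real i) * (1 / x)))"
        proof -
          have "- (b * (s * p * (- h + l / x))) = s * (b * p * (h - l * (1 / x)))" for b s p h l :: real
            by (simp add: algebra_simps)
          thus ?thesis unfolding gig_scale_eq_div_power[OF elim(2), of lam \<omega> i] .
        qed
      qed
      also have "\<dots> = E * ((\<Sum>i<n. (- (\<omega> / 2)) ^ i / fact i * (1 / x) ^ i) - r * (1 / x) ^ n)"
        using assms by (subst sum_gig_b_telescope) (auto simp: r_def)
      finally have S': "- S' x = E * ((\<Sum>i<n. (- (\<omega> / 2)) ^ i / fact i * (1 / x) ^ i) - r * (1 / x) ^ n)" .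
      have "- gig_kernel lam \<omega> x - S' x = - E * (R (1 / x) + r * (1 / x) ^ n)"
        using S' unfolding kernel R_def by (simp add: algebra_simps)
      hence "\<bar>- gig_kernel lam \<omega> x - S' x\<bar> = E * \<bar>R (1 / x) + r * (1 / x) ^ n\<bar>"
        using E by (simp add: abs_mult)
      also have "\<bar>R (1 / x) + r * (1 / x) ^ n\<bar> \<le> \<bar>R (1 / x)\<bar> + \<bar>r\<bar> * (1 / x) ^ n"
        using abs_triangle_ineq[of "R (1 / x)" "r * (1 / x) ^ n"] elim by (simp add: abs_mult)
      also have "\<dots> \<le> (C + \<bar>r\<bar>) * (1 / x) ^ n"
        using elim by (simp add: distrib_right)
      also have "E * ((C + \<bar>r\<bar>) * (1 / x) ^ n) = (C + \<bar>r\<bar>) * gig_scale lam \<omega> n x"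
        using gig_scale_eq_div_power[OF elim(2), of lam \<omega> n] by (simp add: E_def mult_ac)
      also have "\<dots> = 4 * (C + \<bar>r\<bar>) / \<omega> * (gig_scale lam \<omega> n x * (\<omega> / 4))"
        using assms by simp
      also have "\<dots> \<le> 4 * (C + \<bar>r\<bar>) / \<omega> * (gig_scale lam \<omega> n x * (\<omega> / 2 - (lam - 1 - real n) / x))"
      proof (intro mult_left_mono)
        show "\<omega> / 4 \<le> \<omega> / 2 - (lam - 1 - real n) / x" using elim by linarith
        show "0 \<le> gig_scale lam \<omega> n x" using gig_scale_pos[OF elim(2)] less_imp_le by blast
        \<comment> \<open>\<open>C\<close> comes from a big-O bound without a sign; the bound itself
          forces it to be nonnegative.\<close>
        have "0 \<le> C * (1 / x) ^ n" using elim(3) elim(2) by (simp add: abs_of_pos order_trans[OF abs_ge_zero])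
        moreover have "(1 / x) ^ n > 0" using elim(2) by simp
        ultimately have "C \<ge> 0" by (metis mult_neg_pos not_le)
        thus "0 \<le> 4 * (C + \<bar>r\<bar>) / \<omega>" using assms by simp
      qed
      finally show ?case using E by (simp add: mult_left_mono algebra_simps)
    qed
  qed
qed

text \<open>The function whose asymptotic series in \<open>1 / x\<close> is
  \<open>gig_D\<close>.\<close>

definition gig_factor :: "real \<Rightarrow> real \<Rightarrow> real \<Rightarrow> real" where
  "gig_factor lam \<omega> x = gig_tail lam \<omega> x / gig_scale lam \<omega> 0 x"

lemma gig_factor_bigo:
  assumes "\<omega> > 0"
  shows "(\<lambda>x. gig_factor lam \<omega> x - (\<Sum>i<n. gig_b lam \<omega> i * (1 / x) ^ i)) \<in> O[at_top](\<lambda>x. (1 / x) ^ n)"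
proof -
  have "(\<lambda>x. (gig_tail lam \<omega> x - (\<Sum>i<n. gig_b lam \<omega> i * gig_scale lam \<omega> i x)) / gig_scale lam \<omega> 0 x)
      \<in> O[at_top](\<lambda>x. gig_scale lam \<omega> n x / gig_scale lam \<omega> 0 x)"
  proof (intro landau_o.big.divide_right gig_tail_bigo assms)
    show "eventually (\<lambda>x. gig_scale lam \<omega> 0 x \<noteq> 0) at_top"
      using eventually_gt_at_top[of 0] by eventually_elim (metis gig_scale_pos less_irrefl)
  qed
  moreover have "eventually (\<lambda>x. (gig_tail lam \<omega> x - (\<Sum>i<n. gig_b lam \<omega> i * gig_scale lam \<omega> i x)) / gig_scale lam \<omega> 0 x
      = gig_factor lam \<omega> x - (\<Sum>i<n. gig_b lam \<omega> i * (1 / x) ^ i)) at_top"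
    using eventually_gt_at_top[of 0]
  proof eventually_elim
    case (elim x)
    have "(\<Sum>i<n. gig_b lam \<omega> i * gig_scale lam \<omega> i x) =
        (\<Sum>i<n. gig_b lam \<omega> i * (1 / x) ^ i) * gig_scale lam \<omega> 0 x"
      unfolding sum_distrib_right
      by (intro sum.cong refl) (subst gig_scale_eq_div_power[OF elim], simp add: mult_ac)
    thus ?case using gig_scale_pos[OF elim, of lam \<omega> 0]
      by (simp add: gig_factor_def diff_divide_distrib)
  qed
  moreover have "eventually (\<lambda>x. gig_scale lam \<omega> n x / gig_scale lam \<omega> 0 x = (1 / x) ^ n) at_top"
    using eventually_gt_at_top[of 0]
  proof eventually_elim
    case (elim x)
    thus ?case using gig_scale_eq_div_power[OF elim, of lam \<omega> n] gig_scale_pos[OF elim, of lam \<omega> 0] by simp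
  qed
  ultimately show ?thesis by (subst (asm) landau_o.big.cong_ex)
qed

section \<open>The expansion of the quantile function\<close>

text \<open>Serves two changes of variable: \<open>x = Q(u)\<close>, from infinity to
  \<open>u\<close> near 1, and \<open>u \<mapsto> 1 - u\<close>, from there to \<open>u\<close> near
  0.\<close>

lemma asymp_expansion_compose:
  assumes "asymp_expansion f g \<phi> G" "filterlim h G F"
    and "eventually (\<lambda>x. f (h x) = f' x) F" "\<And>n. eventually (\<lambda>x. g n (h x) = g' n x) F"
    and "\<And>n. eventually (\<lambda>x. \<phi> n (h x) = \<phi>' n x) F"
  shows "asymp_expansion f' g' \<phi>' F"
  unfolding asymp_expansion_def
proof (intro conjI allI)
  fix n
  have "(\<lambda>x. \<phi> (Suc n) (h x)) \<in> o[F](\<lambda>x. \<phi> n (h x))"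
    using assms(1) by (intro landau_o.small.compose[OF _ assms(2)]) (auto simp: asymp_expansion_def)
  thus "\<phi>' (Suc n) \<in> o[F](\<phi>' n)"
    by (subst (asm) landau_o.small.cong_ex[OF assms(5) assms(5)])
next
  fix N
  have "(\<lambda>x. f (h x) - (\<Sum>n\<le>N. g n (h x))) \<in> o[F](\<lambda>x. \<phi> N (h x))"
    using assms(1) by (intro landau_o.small.compose[OF _ assms(2)]) (auto simp: asymp_expansion_def)
  moreover have "eventually (\<lambda>x. f (h x) - (\<Sum>n\<le>N. g n (h x)) = f' x - (\<Sum>n\<le>N. g' n x)) F"
  proof -
    have "eventually (\<lambda>x. \<forall>n\<in>{..N}. g n (h x) = g' n x) F"
      by (intro eventually_ball_finite) (auto intro: assms)
    with assms(3) show ?thesis by eventually_elim simp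
  qed
  ultimately show "(\<lambda>x. f' x - (\<Sum>n\<le>N. g' n x)) \<in> o[F](\<phi>' N)"
    by (subst (asm) landau_o.small.cong_ex[OF _ assms(5)])
qed

text \<open>The quantity \<open>y\<close> as a function of \<open>x = Q(u)\<close>; working with it
  avoids inverting any asymptotic relation.\<close>

definition gig_log_tail :: "real \<Rightarrow> real \<Rightarrow> real \<Rightarrow> real" where
  "gig_log_tail lam \<omega> x = - (2 / \<omega>) * ln (gig_tail lam \<omega> x)"

lemma gig_tail_pos: "\<omega> > 0 \<Longrightarrow> x > 0 \<Longrightarrow> gig_tail lam \<omega> x > 0"
  using gig_mass_less_total[of \<omega> x lam] by (simp add: gig_tail_def)

lemma scale_gig_log_tail:
  assumes "\<omega> > 0"
  shows "scale at_top (gig_log_tail lam \<omega>)"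
proof
  have "((\<lambda>x. gig_total lam \<omega> - gig_mass lam \<omega> x) \<longlongrightarrow> gig_total lam \<omega> - gig_total lam \<omega>) at_top"
    by (intro tendsto_intros gig_mass_tendsto_total assms)
  hence "(gig_tail lam \<omega> \<longlongrightarrow> 0) at_top" by (simp add: gig_tail_def [abs_def])
  hence "filterlim (gig_tail lam \<omega>) (at_right 0) at_top"
  proof (rule tendsto_imp_filterlim_at_right)
    show "\<forall>\<^sub>F x in at_top. gig_tail lam \<omega> x > 0"
      using eventually_gt_at_top[of 0] by eventually_elim (rule gig_tail_pos[OF assms])
  qed
  hence "filterlim (\<lambda>x. ln (gig_tail lam \<omega> x)) at_bot at_top"
    by (rule filterlim_compose[OF ln_at_0])
  moreover have "filterlim (\<lambda>t. - (2 / \<omega>) * t) at_top at_bot"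
    using assms by real_asymp
  ultimately show "filterlim (gig_log_tail lam \<omega>) at_top at_top"
    unfolding gig_log_tail_def by (rule filterlim_compose[rotated])
qed

lemma gig_factor_tendsto:
  assumes "\<omega> > 0"
  shows "(gig_factor lam \<omega> \<longlongrightarrow> 2 / \<omega>) at_top"
proof -
  have "(\<lambda>x. gig_factor lam \<omega> x - 2 / \<omega>) \<in> O[at_top](\<lambda>x. 1 / x)"
    using gig_factor_bigo[OF assms, of lam 1] by (simp add: gig_b_0)
  also have "(\<lambda>x::real. 1 / x) \<in> o[at_top](\<lambda>_. 1)" by real_asymp
  finally have "((\<lambda>x. gig_factor lam \<omega> x - 2 / \<omega>) \<longlongrightarrow> 0) at_top"
    by (auto dest: smalloD_tendsto)
  thus ?thesis by (simp add: LIM_zero_iff)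
qed

lemma gig_factor_pos: "\<omega> > 0 \<Longrightarrow> x > 0 \<Longrightarrow> gig_factor lam \<omega> x > 0"
  by (simp add: gig_factor_def gig_tail_pos gig_scale_pos)

lemma gig_log_tail_eq:
  assumes "\<omega> > 0" "x > 0"
  shows "x - gig_log_tail lam \<omega> x = 2 * (lam - 1) / \<omega> * ln x + 2 / \<omega> * ln (gig_factor lam \<omega> x)"
proof -
  have "gig_tail lam \<omega> x = gig_factor lam \<omega> x * (exp (- (\<omega> / 2) * x) * x powr (lam - 1))"
    using gig_scale_pos[OF assms(2), of lam \<omega> 0] assms(2) by (simp add: gig_factor_def gig_scale_def)
  hence "ln (gig_tail lam \<omega> x) = ln (gig_factor lam \<omega> x) + (- (\<omega> / 2) * x + (lam - 1) * ln x)"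
    using assms gig_factor_pos[OF assms, of lam] by (simp add: ln_mult ln_powr)
  thus ?thesis using assms by (simp add: gig_log_tail_def field_simps)
qed

text \<open>
  Bootstrapping: one application of the fixpoint equation gains one order of accuracy, since the
  unknown enters its right-hand side only divided by \<open>y\<close>.
\<close>

lemma approx_gig_log_tail:
  fixes lam \<omega> :: real
  assumes "\<omega> > 0"
  defines "y \<equiv> gig_log_tail lam \<omega>"
  shows "scale.approx at_top y N (\<lambda>x. x - y x) (\<lambda>x. fps_P lam \<omega> (ln (y x)))"
proof -
  interpret scale at_top y
    unfolding y_def by (rule scale_gig_log_tail[OF assms(1)])
  define a where "a = 2 * (lam - 1) / \<omega>"
  define f where "f = (\<lambda>x. x - y x)"
  define A where "A = (\<lambda>x. fps_P lam \<omega> (ln (y x)))"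
  have f_eq: "f x = a * ln x + 2 / \<omega> * ln (gig_factor lam \<omega> x)" if "x > 0" for x
    unfolding f_def y_def a_def by (rule gig_log_tail_eq[OF assms(1) that])
  have ln_factor: "((\<lambda>x. ln (gig_factor lam \<omega> x)) \<longlongrightarrow> ln (2 / \<omega>)) at_top"
    using assms by (intro tendsto_ln gig_factor_tendsto) auto

  \<comment> \<open>A crude a priori estimate starts the bootstrapping: the exact equation controls
    \<open>f\<close> by \<open>ln x\<close>, whereas growth is measured in \<open>y\<close>, so
    \<open>x\<close> must first be bounded by a multiple of \<open>y x\<close>.\<close>
  have "((\<lambda>x. f x / x) \<longlongrightarrow> 0) at_top"
  proof (rule Lim_transform_eventually)
    have "((\<lambda>x::real. ln x / x) \<longlongrightarrow> 0) at_top" "((\<lambda>x::real. 1 / x) \<longlongrightarrow> 0) at_top"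
      by real_asymp+
    from tendsto_add[OF tendsto_mult[OF tendsto_const[of a] this(1)]
        tendsto_mult[OF tendsto_mult[OF tendsto_const[of "2 / \<omega>"] ln_factor] this(2)]]
    show "((\<lambda>x. a * (ln x / x) + 2 / \<omega> * ln (gig_factor lam \<omega> x) * (1 / x)) \<longlongrightarrow> 0) at_top"
      by simp
    show "\<forall>\<^sub>F x in at_top. a * (ln x / x) + 2 / \<omega> * ln (gig_factor lam \<omega> x) * (1 / x) = f x / x"
      using eventually_gt_at_top[of 0] by eventually_elim (simp add: f_eq add_divide_distrib)
  qed
  hence "eventually (\<lambda>x. f x / x < 1 / 2) at_top"
    by (rule order_tendstoD) simp
  hence x_le: "eventually (\<lambda>x. x \<le> 2 * y x) at_top"
    using eventually_gt_at_top[of 0] by eventually_elim (simp add: f_def field_simps)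

  have slow_ln_x: "slow 0 ln"
  proof (rule slow_bigo)
    show "slow 0 (\<lambda>x. ln 2 + ln (y x))"
      by (intro slow_add slow_const slow_ln)
    show "ln \<in> O[at_top](\<lambda>x. ln 2 + ln (y x))"
    proof (rule bigoI[of _ 1])
      show "\<forall>\<^sub>F x in at_top. norm (ln x) \<le> 1 * norm (ln 2 + ln (y x))"
        using x_le eventually_gt_at_top[of 1]
      proof eventually_elim
        case (elim x)
        hence "ln x \<le> ln (2 * y x)" "ln x \<ge> 0" by simp_all
        moreover have "ln (2 * y x) = ln 2 + ln (y x)"
          using elim by (subst ln_mult) auto
        ultimately show ?case by simp
      qed
    qed
  qed
  have slow_ln_factor: "slow 0 (\<lambda>x. ln (gig_factor lam \<omega> x))"
  proof (rule slow_bigo[OF slow_const])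
    show "(\<lambda>x. ln (gig_factor lam \<omega> x)) \<in> O[at_top](\<lambda>_. 1)"
      by (rule bigoI_tendsto[OF _ always_eventually]) (use ln_factor in auto)
  qed
  have slow_f: "slow 0 f"
  proof (rule slow_bigo)
    show "slow 0 (\<lambda>x. a * ln x + 2 / \<omega> * ln (gig_factor lam \<omega> x))"
      by (intro slow_add slow_cmult slow_ln_x slow_ln_factor)
    show "f \<in> O[at_top](\<lambda>x. a * ln x + 2 / \<omega> * ln (gig_factor lam \<omega> x))"
      by (intro bigoI[of _ 1] eventually_mono[OF eventually_gt_at_top[of 0]]) (simp add: f_eq)
  qed

  have "approx N f A" for N
  proof (induction N)
    case 0
    show ?case
      by (rule approx_0I[OF slow_f]) (simp add: A_def fps_P_def gig_P_eq_poly slow_poly_ln)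
  next
    case (Suc N)
    define h where "h = (\<lambda>x. f x / y x)"
    define Z where "Z = (\<lambda>x. fps_X / (1 + fps_X * A x))"
    have h: "approx (Suc N) h (\<lambda>x. fps_X * A x)"
      unfolding h_def by (rule approx_div_y[OF Suc.IH])
    have slow_h: "slow (Suc 0) h"
      by (rule approx_imp_slow_Suc[OF h]) simp
    have y_h: "eventually (\<lambda>x. x > 0 \<and> y x > 0 \<and> 1 + h x = x / y x) at_top"
      using y_pos eventually_gt_at_top[of 0]
      by eventually_elim (simp add: h_def f_def field_simps)

    have ln_h: "approx (Suc N) (\<lambda>x. ln (1 + h x)) (\<lambda>x. fps_ln 1 oo (fps_X * A x))"
      by (intro approx_compose_fps_expansion[OF h _ slow_h] has_fps_expansion_ln_one_plus) simp

    \<comment> \<open>By \<open>x = y x * (1 + h x)\<close>, this is \<open>1 / x\<close>. Its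
      series \<open>t / (1 + t * A)\<close> is the argument of \<open>D\<close> in the formal
      recursion.\<close>
    have "approx (Suc N) (\<lambda>x. 1 / y x * inverse (1 + h x))
        (\<lambda>x. (fps_X * fps_const 1) * (inverse (1 + fps_X) oo (fps_X * A x)))"
      by (intro approx_mult approx_div_y approx_const
           approx_compose_fps_expansion[OF h _ slow_h] has_fps_expansion_inverse_one_plus) simp
    moreover have "eventually (\<lambda>x. 1 / y x * inverse (1 + h x) = 1 / x) at_top"
      using y_h by eventually_elim (simp add: field_simps)
    ultimately have Z: "approx (Suc N) (\<lambda>x. 1 / x) Z"
      unfolding Z_def fps_X_div_one_plus_X_mult using approx_eventually_cong by simp
    have slow_Z: "slow (Suc 0) (\<lambda>x. 1 / x)"
      by (rule approx_imp_slow_Suc[OF Z]) (simp add: Z_def)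

    \<comment> \<open>Here the outer series \<open>gig_D\<close> is known only through remainder
      estimates at infinity, so the truncated form of composition is required.\<close>
    have factor: "approx (Suc N) (gig_factor lam \<omega>) (\<lambda>x. gig_D lam \<omega> oo Z x)"
    proof (rule approx_compose[OF Z])
      have "slow (Suc N) (\<lambda>x. (1 / x) ^ Suc N)"
        using slow_power[OF slow_Z, of "Suc N"] by simp
      thus "slow (Suc N) (\<lambda>x. gig_factor lam \<omega> x - (\<Sum>i<Suc N. gig_D lam \<omega> $ i * (1 / x) ^ i))"
        by (rule slow_bigo) (use gig_factor_bigo[OF assms(1), of lam "Suc N"] in \<open>simp add: gig_D_def\<close>)
    qed (simp add: Z_def)
    have "approx (Suc N) (\<lambda>x. ln (gig_factor lam \<omega> x)) (\<lambda>x. fps_log (gig_D lam \<omega> oo Z x))"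
    proof (rule approx_ln_fps_log[OF factor, of "2 / \<omega>"])
      show "slow (Suc 0) (\<lambda>x. gig_factor lam \<omega> x - 2 / \<omega>)"
        by (rule slow_bigo[OF slow_Z]) (use gig_factor_bigo[OF assms(1), of lam 1] in \<open>simp add: gig_b_0\<close>)
    qed (use assms in \<open>simp_all add: gig_D_def gig_b_0\<close>)
    moreover have "fps_log (gig_D lam \<omega> oo Z x) = fps_log (gig_D lam \<omega>) oo Z x" for x
      by (rule fps_log_compose) (simp add: Z_def)
    ultimately have ln_factor: "approx (Suc N) (\<lambda>x. ln (gig_factor lam \<omega> x)) (\<lambda>x. fps_log (gig_D lam \<omega>) oo Z x)"
      by simp

    have "approx (Suc N) (\<lambda>x. a * ln (y x) + a * ln (1 + h x) + 2 / \<omega> * ln (gig_factor lam \<omega> x))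
       (\<lambda>x. fps_const (a * ln (y x)) + fps_const a * (fps_ln 1 oo (fps_X * A x)) +
            fps_const (2 / \<omega>) * (fps_log (gig_D lam \<omega>) oo Z x))"
      by (intro approx_add approx_cmult ln_h ln_factor approx_slow_const slow_cmult slow_ln)
    \<comment> \<open>The formal fixpoint, taken for each \<open>x\<close> at the parameter
      \<open>\<xi> = ln (y x)\<close>, returns the same coefficients \<open>A x\<close>.\<close>
    moreover have "fps_const (a * ln (y x)) + fps_const a * (fps_ln 1 oo (fps_X * A x)) +
            fps_const (2 / \<omega>) * (fps_log (gig_D lam \<omega>) oo Z x) = A x" for x
      using fps_P_fixpoint[of \<omega> lam "ln (y x)"] assms(1)
      unfolding gig_step_def a_def [symmetric] A_def Z_def by simp
    moreover have "eventually (\<lambda>x. a * ln (y x) + a * ln (1 + h x) + 2 / \<omega> * ln (gig_factor lam \<omega> x) = f x) at_top"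
      using y_h
    proof eventually_elim
      case (elim x)
      hence "ln (1 + h x) = ln x - ln (y x)" by (simp add: ln_div)
      thus ?case unfolding f_eq[OF conjunct1[OF elim]] by (simp add: right_diff_distrib)
    qed
    ultimately show ?case using approx_eventually_cong by simp
  qed
  thus ?thesis by (simp add: f_def A_def)
qed

lemma asymp_expansion_gig_log_tail:
  fixes lam \<omega> :: real
  assumes "\<omega> > 0"
  defines "y \<equiv> gig_log_tail lam \<omega>"
  shows "asymp_expansion (\<lambda>x. x - y x) (\<lambda>n x. gig_P lam \<omega> (gig_c lam \<omega>) n (ln (y x)) / y x ^ n)
           (\<lambda>n x. 1 / y x ^ n) at_top"
proof -
  interpret scale at_top y
    unfolding y_def by (rule scale_gig_log_tail[OF assms(1)])
  show ?thesis
    unfolding asymp_expansion_def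
  proof (intro conjI allI slow_imp_smallo slow_inverse_power)
    fix N
    \<comment> \<open>Approximation of order \<open>Suc N\<close> retains exactly the terms
      \<open>n \<le> N\<close>; its surplus order is what turns the error into a little-o of
      \<open>1 / y x ^ N\<close>.\<close>
    show "slow (Suc N) (\<lambda>x. x - y x - (\<Sum>n\<le>N. gig_P lam \<omega> (gig_c lam \<omega>) n (ln (y x)) / y x ^ n))"
      using approx_gig_log_tail[OF assms(1), of lam "Suc N"]
      unfolding y_def [symmetric] approx_def lessThan_Suc_atMost by (simp add: fps_P_def)
  qed
qed

lemma gig_log_tail_quantile:
  assumes "\<omega> > 0" "0 < u" "u < 1"
  shows "gig_log_tail lam \<omega> (gig_quantile lam \<omega> u) = gig_y lam \<omega> u"
proof -
  have "gig_mass lam \<omega> (gig_quantile lam \<omega> u) = 2 * bessel_K lam \<omega> * u"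
    using gig_cdf_quantile[OF assms, of lam] bessel_K_pos[OF assms(1), of lam]
    by (simp add: gig_cdf_eq field_simps)
  thus ?thesis
    using assms by (simp add: gig_log_tail_def gig_tail_def gig_y_def gig_v_def gig_total_eq algebra_simps)
qed

lemma filterlim_gig_quantile:
  assumes "\<omega> > 0"
  shows "filterlim (gig_quantile lam \<omega>) at_top (at_left 1)"
  unfolding filterlim_at_top_gt[of _ _ 0]
proof (intro allI impI)
  fix x :: real assume "x > 0"
  have "gig_cdf lam \<omega> x \<in> {0<..<1}"
    using bij_betw_gig_cdf[OF assms, of lam] \<open>x > 0\<close> by (auto simp: bij_betw_def)
  hence cdf: "gig_cdf lam \<omega> x < 1" "gig_cdf lam \<omega> x > 0" by auto
  from eventually_at_left_real[OF cdf(1)] show "\<forall>\<^sub>F u in at_left 1. x \<le> gig_quantile lam \<omega> u"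
  proof eventually_elim
    case (elim u)
    hence u: "0 < u" "u < 1" using \<open>gig_cdf lam \<omega> x > 0\<close> by auto
    show ?case
    proof (rule ccontr)
      assume "\<not> x \<le> gig_quantile lam \<omega> u"
      hence "gig_cdf lam \<omega> (gig_quantile lam \<omega> u) < gig_cdf lam \<omega> x"
        using gig_quantile_pos[OF assms u] by (intro gig_cdf_strict_mono[OF assms]) auto
      thus False using gig_cdf_quantile[OF assms u, of lam] elim by simp
    qed
  qed
qed

lemma asymp_expansion_gig_quantile:
  assumes "\<omega> > 0"
  shows "asymp_expansion
       (\<lambda>u. gig_quantile lam \<omega> u - gig_y lam \<omega> u)
       (\<lambda>n u. gig_P lam \<omega> (gig_c lam \<omega>) n (ln (gig_y lam \<omega> u)) / gig_y lam \<omega> u ^ n)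
       (\<lambda>n u. 1 / gig_y lam \<omega> u ^ n)
       (at_left 1)"
proof -
  have "eventually (\<lambda>u::real. u \<in> {0<..<1}) (at_left 1)"
    by (intro eventually_at_left_real) simp
  hence y: "eventually (\<lambda>u. gig_log_tail lam \<omega> (gig_quantile lam \<omega> u) = gig_y lam \<omega> u) (at_left 1)"
    by eventually_elim (simp add: gig_log_tail_quantile[OF assms])
  show ?thesis
    using y by (intro asymp_expansion_compose[OF asymp_expansion_gig_log_tail[OF assms, of lam]
          filterlim_gig_quantile[OF assms, of lam]]) (auto elim!: eventually_mono)
qed

lemma asymp_expansion_inverse_gig_quantile:
  assumes "\<omega> > 0"
  shows "asymp_expansion
         (\<lambda>u. 1 / gig_quantile lam \<omega> u - gig_y (- lam) \<omega> (1 - u))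
         (\<lambda>n u. gig_P (- lam) \<omega> (gig_c (- lam) \<omega>) n (ln (gig_y (- lam) \<omega> (1 - u)))
                / gig_y (- lam) \<omega> (1 - u) ^ n)
         (\<lambda>n u. 1 / gig_y (- lam) \<omega> (1 - u) ^ n)
         (at_right 0)"
proof (rule asymp_expansion_compose[OF asymp_expansion_gig_quantile[OF assms]])
  show "filterlim (\<lambda>u::real. 1 - u) (at_left 1) (at_right 0)" by real_asymp
  have "eventually (\<lambda>u::real. u \<in> {0<..<1}) (at_right 0)"
    by (intro eventually_at_right_real) simp
  thus "\<forall>\<^sub>F u in at_right 0. gig_quantile (- lam) \<omega> (1 - u) - gig_y (- lam) \<omega> (1 - u) =
      1 / gig_quantile lam \<omega> u - gig_y (- lam) \<omega> (1 - u)"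
    by eventually_elim (simp add: gig_quantile_reflect[OF assms, of _ lam])
qed auto

lemma gig_P_0_eq:
  assumes "\<omega> > 0"
  shows "gig_P lam \<omega> (gig_c lam \<omega>) 0 \<xi> = 2 * ((lam - 1) * \<xi> + ln (2 / \<omega>)) / \<omega>"
  by (simp add: gig_c_0[OF assms] add_divide_distrib distrib_left)

lemma gig_P_1_eq:
  assumes "\<omega> > 0"
  shows "gig_P lam \<omega> (gig_c lam \<omega>) 1 \<xi> =
    (4 * lam - \<omega>\<^sup>2 - 4 + 4 * (lam - 1)\<^sup>2 * \<xi> + 4 * (lam - 1) * ln (2 / \<omega>)) / \<omega>\<^sup>2"
proof -
  have "gig_P lam \<omega> (gig_c lam \<omega>) 1 \<xi> = (2 * (lam - 1) / \<omega>)\<^sup>2 * \<xi> + gig_c lam \<omega> 1"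
    by (simp add: power2_eq_square)
  also have "(2 * (lam - 1) / \<omega>)\<^sup>2 * \<xi> = 4 * (lam - 1)\<^sup>2 * \<xi> / \<omega>\<^sup>2"
    by (simp only: power_mult_distrib power_divide) simp
  finally show ?thesis
    unfolding gig_c_1[OF assms] by (simp add: add_divide_distrib diff_divide_distrib)
qed

theorem mainTheorem8:
  fixes lam \<omega> :: real
  assumes "\<omega> > 0"
  shows
    "asymp_expansion
       (\<lambda>u. gig_quantile lam \<omega> u - gig_y lam \<omega> u)
       (\<lambda>n u. gig_P lam \<omega> (gig_c lam \<omega>) n (ln (gig_y lam \<omega> u)) / gig_y lam \<omega> u ^ n)
       (\<lambda>n u. 1 / gig_y lam \<omega> u ^ n)
       (at_left 1)
     \<and> (\<exists>p :: real poly. gig_P lam \<omega> (gig_c lam \<omega>) 0 = poly p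
           \<and> degree p \<le> 1 \<and> (lam \<noteq> 1 \<longrightarrow> degree p = 1))
     \<and> (\<forall>n\<ge>1. \<exists>p :: real poly. gig_P lam \<omega> (gig_c lam \<omega>) n = poly p
           \<and> degree p \<le> n \<and> (lam \<noteq> 1 \<longrightarrow> degree p = n))
     \<and> (\<forall>n. \<forall>k\<le>n. gig_c lam \<omega> k = fps_nth (gig_u lam \<omega> (n + 1)) k)
     \<and> (\<forall>\<xi>. gig_P lam \<omega> (gig_c lam \<omega>) 0 \<xi> =
             2 * ((lam - 1) * \<xi> + ln (2 / \<omega>)) / \<omega>)
     \<and> (\<forall>\<xi>. gig_P lam \<omega> (gig_c lam \<omega>) 1 \<xi> =
             (4 * lam - \<omega>\<^sup>2 - 4 + 4 * (lam - 1)\<^sup>2 * \<xi> + 4 * (lam - 1) * ln (2 / \<omega>)) / \<omega>\<^sup>2)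
     \<and> (\<lambda>u. gig_quantile lam \<omega> u
            - (gig_y lam \<omega> u
               + 2 * ((lam - 1) * ln (gig_y lam \<omega> u) + ln (2 / \<omega>)) / \<omega>
               + (4 * lam - \<omega>\<^sup>2 - 4 + 4 * (lam - 1)\<^sup>2 * ln (gig_y lam \<omega> u)
                    + 4 * (lam - 1) * ln (2 / \<omega>)) / (\<omega>\<^sup>2 * gig_y lam \<omega> u)))
         \<in> o[at_left 1](\<lambda>u. 1 / gig_y lam \<omega> u)
     \<and> (\<forall>u. 0 < u \<and> u < 1 \<longrightarrow>
            gig_quantile lam \<omega> u = 1 / gig_quantile (- lam) \<omega> (1 - u))
     \<and> asymp_expansion
         (\<lambda>u. 1 / gig_quantile lam \<omega> u - gig_y (- lam) \<omega> (1 - u))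
         (\<lambda>n u. gig_P (- lam) \<omega> (gig_c (- lam) \<omega>) n (ln (gig_y (- lam) \<omega> (1 - u)))
                / gig_y (- lam) \<omega> (1 - u) ^ n)
         (\<lambda>n u. 1 / gig_y (- lam) \<omega> (1 - u) ^ n)
         (at_right 0)"
proof -
  let ?c = "gig_c lam \<omega>" and ?y = "gig_y lam \<omega>"
  \<comment> \<open>The value \<open>max 1 n\<close> covers both degree claims, \<open>n = 0\<close>
    and \<open>n \<ge> 1\<close>.\<close>
  have poly: "gig_P lam \<omega> ?c n = poly (gig_poly lam \<omega> ?c n) \<and> degree (gig_poly lam \<omega> ?c n) \<le> max 1 n
      \<and> (lam \<noteq> 1 \<longrightarrow> degree (gig_poly lam \<omega> ?c n) = max 1 n)" for n
    using degree_gig_poly_le degree_gig_poly[of lam \<omega>] assms by (auto simp: gig_P_eq_poly)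
  have "(\<lambda>u. gig_quantile lam \<omega> u - ?y u - (\<Sum>n\<le>1. gig_P lam \<omega> ?c n (ln (?y u)) / ?y u ^ n))
      \<in> o[at_left 1](\<lambda>u. 1 / ?y u ^ 1)"
    using asymp_expansion_gig_quantile[OF assms, of lam] unfolding asymp_expansion_def by blast
  also have "(\<lambda>u. gig_quantile lam \<omega> u - ?y u - (\<Sum>n\<le>1. gig_P lam \<omega> ?c n (ln (?y u)) / ?y u ^ n)) =
     (\<lambda>u. gig_quantile lam \<omega> u
            - (?y u
               + 2 * ((lam - 1) * ln (?y u) + ln (2 / \<omega>)) / \<omega>
               + (4 * lam - \<omega>\<^sup>2 - 4 + 4 * (lam - 1)\<^sup>2 * ln (?y u)
                    + 4 * (lam - 1) * ln (2 / \<omega>)) / (\<omega>\<^sup>2 * ?y u)))"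
  proof
    fix u
    have "(\<Sum>n\<le>1. gig_P lam \<omega> ?c n (ln (?y u)) / ?y u ^ n) =
        gig_P lam \<omega> ?c 0 (ln (?y u)) + gig_P lam \<omega> ?c 1 (ln (?y u)) / ?y u"
      by simp
    thus "gig_quantile lam \<omega> u - ?y u - (\<Sum>n\<le>1. gig_P lam \<omega> ?c n (ln (?y u)) / ?y u ^ n) =
        gig_quantile lam \<omega> u
            - (?y u
               + 2 * ((lam - 1) * ln (?y u) + ln (2 / \<omega>)) / \<omega>
               + (4 * lam - \<omega>\<^sup>2 - 4 + 4 * (lam - 1)\<^sup>2 * ln (?y u)
                    + 4 * (lam - 1) * ln (2 / \<omega>)) / (\<omega>\<^sup>2 * ?y u))"
      by (simp only: gig_P_0_eq[OF assms] gig_P_1_eq[OF assms] divide_divide_eq_left diff_diff_eq add.assoc)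
  qed
  finally have two_terms: "(\<lambda>u. gig_quantile lam \<omega> u
            - (?y u
               + 2 * ((lam - 1) * ln (?y u) + ln (2 / \<omega>)) / \<omega>
               + (4 * lam - \<omega>\<^sup>2 - 4 + 4 * (lam - 1)\<^sup>2 * ln (?y u)
                    + 4 * (lam - 1) * ln (2 / \<omega>)) / (\<omega>\<^sup>2 * ?y u)))
      \<in> o[at_left 1](\<lambda>u. 1 / ?y u)"
    by (simp only: power_one_right)
  show ?thesis
  proof (intro conjI)
    show "\<exists>p :: real poly. gig_P lam \<omega> ?c 0 = poly p \<and> degree p \<le> 1 \<and> (lam \<noteq> 1 \<longrightarrow> degree p = 1)"
      using poly[of 0] by auto
    show "\<forall>n\<ge>1. \<exists>p :: real poly. gig_P lam \<omega> ?c n = poly p \<and> degree p \<le> n \<and> (lam \<noteq> 1 \<longrightarrow> degree p = n)"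
      using poly by (metis max.absorb2)
    show "\<forall>n. \<forall>k\<le>n. ?c k = fps_nth (gig_u lam \<omega> (n + 1)) k"
      by (metis gig_u_nth_stable less_Suc_eq_le Suc_eq_plus1)
  qed (use two_terms asymp_expansion_gig_quantile asymp_expansion_inverse_gig_quantile
      gig_P_0_eq gig_P_1_eq gig_quantile_reflect assms in blast)+
qed

end
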